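(* Let $\mathcal{A}$ be a finite structure with domain $A$, $|A|=n$, let $x\in A$ be named by a constant of $\mathcal{A}$, and let $p>0$. The following are equivalent: (i) $\mathcal{A}$ is $p$-collapsible from $\{x\}$. (ii) For every $m\geq1$, the full adversary $A^m$ is reactively composable from $\Upsilon_{m,p,\{x\}}$. (iii) $\mathcal{A}$ is $\Pi_2$-$p$-collapsible from $\{x\}$. (iv) For every $m\geq1$, $\Upsilon_{m,p,\{x\}}$ generates $A^m$. (v) $\mathcal{A}\models\phi_{n,\Upsilon_{p+1,p,\{x\}},\mathcal{A}}$.
   Context: $\mathcal{A}$ is a finite structure over a finite relational signature $\sigma$ (constant symbols treated as unary singleton relations, so polymorphisms fix them). Polymorphism: map $f:A^k\to A$ preserving all relations coordinatewise. pH-sentence: prenex sentence with only $\exists,\forall,\wedge$ over atoms (including equality); $\Pi_2$: prefix $\forall^*\exists^*$. An adversary of length $m$ is a subset of $A^m$; $\mathcal{A}\models\phi_{\upharpoonright\mathscr{B}}$ means there are Skolem functions for the existential variables (each depending on the universal variables preceding it) such that the quantifier-free part is satisfied for every assignment of the universal variables $x_1,\dots,x_m$ (in prefix order) whose tuple lies in $\mathscr{B}$; for a set of adversaries, for each member. $\Upsilon_{m,p,\{x\}}$ is the set of adversaries $B_1\times\dots\times B_m$ with exactly $p$ of the $B_i$ equal to $A$ and the rest equal to $\{x\}$. $\mathcal{A}$ is $p$-collapsible from $\{x\}$ if for every $m\ge1$ and pH-sentence $\phi$ with $m$ universal variables, $\mathcal{A}\models\phi_{\upharpoonright\Upsilon_{m,p,\{x\}}}$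 implies $\mathcal{A}\models\phi$; $\Pi_2$-$p$-collapsible: same for $\Pi_2$-pH-sentences. Reactive composability of $A^m$ from $\{\mathscr{B}_1,\dots,\mathscr{B}_k\}$: there are a $k$-ary polymorphism $f$ and partial maps $g^j_i:A^i\to A$ ($i\in[m]$, $j\in[k]$) such that for every $(a_1,\dots,a_m)\in A^m$, each $(g^j_1(a_1),\dots,g^j_m(a_1,\dots,a_m))$ is defined and in $\mathscr{B}_j$, and $a_i=f(g^1_i(a_1,\dots,a_i),\dots,g^k_i(a_1,\dots,a_i))$ for all $i$. A set $\Omega$ of adversaries generates $A^m$ if every $t\in A^m$ equals $f(t_1,\dots,t_k)$ coordinatewise for some polymorphism $f$ and $t_1,\dots,t_k\in\bigcup\Omega$. Canonical sentence: a map $\mu:[n]\times[m]\to A$ is consistent with an adversary $\mathscr{O}$ if $(\mu(i_1,1),\dots,\mu(i_m,m))\in\mathscr{O}$ for all $(i_1,\dots,i_m)\in[n]^m$; $\mathfrak{A}_\mu$ expands $\mathcal{A}$ by constants $c_{i,j}\mapsto\mu(i,j)$; $\phi_{n,\Omega,\mathcal{A}}$ is the canonical query (conjunction of all atoms true, one variable per element) of the $\sigma$-reduct of the product $\bigotimes_{\mathscr{O}\in\Omega}\bigotimes_{\mu\text{ consistent with }\mathscr{O}}\mathfrak{A}_\mu$ (relations and constants componentwise), where the variable for the interpretation of $c_{i,j}$ is renamed $w_{i,j}$ and universally quantified outermost, all other variables existentially quantified.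
   Formalization: For m < p, where "exactly p of the B_i equal to A" is impossible (an empty Υ makes the equivalence false for p ≥ 2), Υ_{m,p,{x}} is taken as {A^m}; and "exactly p" means a choice of p positions carrying A, which matters only if A = {x}. *)

theory Defs
  imports Main "HOL-Library.FuncSet"
begin

record 'r signature =
  symbols :: "'r set"
  arity :: "'r \<Rightarrow> nat"

record ('r, 'a) rel_structure =
  carrier :: "'a set"
  interp :: "'r \<Rightarrow> 'a list set"

definition tuples :: "'a set \<Rightarrow> nat \<Rightarrow> 'a list set" where
  "tuples A m = {t. length t = m \<and> set t \<subseteq> A}"

definition finite_structure :: "'r signature \<Rightarrow> ('r, 'a) rel_structure \<Rightarrow> bool" where
  "finite_structure \<sigma> \<A> \<longleftrightarrow>
     finite (symbols \<sigma>) \<and> finite (carrier \<A>) \<and> carrier \<A> \<noteq> {} \<and>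
     (\<forall>R \<in> symbols \<sigma>. interp \<A> R \<subseteq> tuples (carrier \<A>) (arity \<sigma> R))"

text \<open>Constant symbols are unary relation symbols interpreted by singletons.\<close>

definition named_by_constant :: "'r signature \<Rightarrow> ('r, 'a) rel_structure \<Rightarrow> 'a \<Rightarrow> bool" where
  "named_by_constant \<sigma> \<A> x \<longleftrightarrow> (\<exists>c \<in> symbols \<sigma>. arity \<sigma> c = 1 \<and> interp \<A> c = {[x]})"


section \<open>Polymorphisms\<close>

definition apply_coordwise :: "('a list \<Rightarrow> 'a) \<Rightarrow> nat \<Rightarrow> 'a list list \<Rightarrow> 'a list" where
  "apply_coordwise f m ts = map (\<lambda>i. f (map (\<lambda>t. t ! i) ts)) [0..<m]"

definition polymorphism ::
  "'r signature \<Rightarrow> ('r, 'a) rel_structure \<Rightarrow> nat \<Rightarrow> ('a list \<Rightarrow> 'a) \<Rightarrow> bool" where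
  "polymorphism \<sigma> \<A> k f \<longleftrightarrow>
     k \<ge> 1 \<and>
     (\<forall>t \<in> tuples (carrier \<A>) k. f t \<in> carrier \<A>) \<and>
     (\<forall>R \<in> symbols \<sigma>. \<forall>ts. length ts = k \<and> set ts \<subseteq> interp \<A> R \<longrightarrow>
        apply_coordwise f (arity \<sigma> R) ts \<in> interp \<A> R)"


section \<open>Positive Horn sentences\<close>

datatype quantifier = Forall | Exists

datatype ('r, 'v) atom = Rel 'r "'v list" | Eq 'v 'v

primrec atom_vars :: "('r, 'v) atom \<Rightarrow> 'v set" where
  "atom_vars (Rel R vs) = set vs"
| "atom_vars (Eq u v) = {u, v}"

primrec atom_in_signature :: "'r signature \<Rightarrow> ('r, 'v) atom \<Rightarrow> bool" where
  "atom_in_signature \<sigma> (Rel R vs) \<longleftrightarrow> R \<in> symbols \<sigma> \<and> length vs = arity \<sigma> R"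
| "atom_in_signature \<sigma> (Eq u v) \<longleftrightarrow> True"

text \<open>The quantifier-free part is the conjunction of the atoms in \<^term>\<open>body\<close>.\<close>

record ('r, 'v) prenex =
  quants :: "(quantifier \<times> 'v) list"
  body :: "('r, 'v) atom set"

definition pH_sentence :: "'r signature \<Rightarrow> ('r, 'v) prenex \<Rightarrow> bool" where
  "pH_sentence \<sigma> \<phi> \<longleftrightarrow>
     distinct (map snd (quants \<phi>)) \<and> finite (body \<phi>) \<and>
     (\<forall>\<alpha> \<in> body \<phi>. atom_in_signature \<sigma> \<alpha> \<and> atom_vars \<alpha> \<subseteq> snd ` set (quants \<phi>))"

definition Pi2 :: "('r, 'v) prenex \<Rightarrow> bool" where
  "Pi2 \<phi> \<longleftrightarrow> (\<exists>us es. quants \<phi> = map (Pair Forall) us @ map (Pair Exists) es)"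

definition count_universal :: "(quantifier \<times> 'v) list \<Rightarrow> nat" where
  "count_universal qs = length (filter (\<lambda>(q, v). q = Forall) qs)"

primrec atom_holds :: "('r, 'a) rel_structure \<Rightarrow> ('v \<Rightarrow> 'a) \<Rightarrow> ('r, 'v) atom \<Rightarrow> bool" where
  "atom_holds \<A> e (Rel R vs) \<longleftrightarrow> map e vs \<in> interp \<A> R"
| "atom_holds \<A> e (Eq u v) \<longleftrightarrow> e u = e v"

fun sat_prefix ::
  "('r, 'a) rel_structure \<Rightarrow> (quantifier \<times> 'v) list \<Rightarrow> ('r, 'v) atom set \<Rightarrow> ('v \<Rightarrow> 'a) \<Rightarrow> bool" where
  "sat_prefix \<A> [] \<Gamma> e \<longleftrightarrow> (\<forall>\<alpha> \<in> \<Gamma>. atom_holds \<A> e \<alpha>)"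
| "sat_prefix \<A> ((Forall, v) # qs) \<Gamma> e \<longleftrightarrow> (\<forall>a \<in> carrier \<A>. sat_prefix \<A> qs \<Gamma> (e(v := a)))"
| "sat_prefix \<A> ((Exists, v) # qs) \<Gamma> e \<longleftrightarrow> (\<exists>a \<in> carrier \<A>. sat_prefix \<A> qs \<Gamma> (e(v := a)))"

text \<open>The initial environment is irrelevant for sentences.\<close>

definition models :: "('r, 'a) rel_structure \<Rightarrow> ('r, 'v) prenex \<Rightarrow> bool" where
  "models \<A> \<phi> \<longleftrightarrow> sat_prefix \<A> (quants \<phi>) (body \<phi>) (\<lambda>_. undefined)"


section \<open>Adversaries\<close>

text \<open>
  An adversary of length \<open>m\<close> is a subset of \<^term>\<open>tuples A m\<close>. The number of universal
  variables strictly before a universal variable is also its 0-based position among the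
  universal variables.
\<close>

definition universals_before :: "('r, 'v) prenex \<Rightarrow> 'v \<Rightarrow> nat" where
  "universals_before \<phi> v = count_universal (takeWhile (\<lambda>(q, w). w \<noteq> v) (quants \<phi>))"

definition skolem_env ::
  "('r, 'v) prenex \<Rightarrow> ('v \<Rightarrow> 'a list \<Rightarrow> 'a) \<Rightarrow> 'a list \<Rightarrow> 'v \<Rightarrow> 'a" where
  "skolem_env \<phi> s t v =
     (if (Forall, v) \<in> set (quants \<phi>) then t ! universals_before \<phi> v
      else s v (take (universals_before \<phi> v) t))"

definition models_adversary ::
  "('r, 'a) rel_structure \<Rightarrow> ('r, 'v) prenex \<Rightarrow> 'a list set \<Rightarrow> bool" where
  "models_adversary \<A> \<phi> B \<longleftrightarrow>
     (\<exists>s. (\<forall>v. \<forall>t \<in> tuples (carrier \<A>) (universals_before \<phi> v). s v t \<in> carrier \<A>) \<and>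
          (\<forall>t \<in> B. \<forall>\<alpha> \<in> body \<phi>. atom_holds \<A> (skolem_env \<phi> s t) \<alpha>))"

definition models_adversaries ::
  "('r, 'a) rel_structure \<Rightarrow> ('r, 'v) prenex \<Rightarrow> 'a list set set \<Rightarrow> bool" where
  "models_adversaries \<A> \<phi> \<Omega> \<longleftrightarrow> (\<forall>B \<in> \<Omega>. models_adversary \<A> \<phi> B)"

text \<open>
  The set \<open>I\<close> collects the \<open>p\<close> positions carrying the whole domain \<open>A\<close>; all other positions
  carry \<open>S\<close>. If \<open>m < p\<close> there are not enough positions, and the convention is that all of
  them carry \<open>A\<close>. Choosing positions rather than counting the components equal to \<open>A\<close> matters
  only when \<open>S = A\<close>.
\<close>

definition Upsilon :: "'a set \<Rightarrow> nat \<Rightarrow> nat \<Rightarrow> 'a set \<Rightarrow> 'a list set set" where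
  "Upsilon A m p S =
     {listset (map (\<lambda>i. if i \<in> I then A else S) [0..<m]) | I. I \<subseteq> {..<m} \<and> card I = min p m}"

text \<open>Natural numbers serve as the supply of variable names.\<close>

definition collapsible ::
  "'r signature \<Rightarrow> ('r, 'a) rel_structure \<Rightarrow> nat \<Rightarrow> 'a set \<Rightarrow> bool" where
  "collapsible \<sigma> \<A> p S \<longleftrightarrow>
     (\<forall>m \<ge> 1. \<forall>\<phi> :: ('r, nat) prenex.
        pH_sentence \<sigma> \<phi> \<and> count_universal (quants \<phi>) = m \<and>
        models_adversaries \<A> \<phi> (Upsilon (carrier \<A>) m p S) \<longrightarrow> models \<A> \<phi>)"

definition Pi2_collapsible ::
  "'r signature \<Rightarrow> ('r, 'a) rel_structure \<Rightarrow> nat \<Rightarrow> 'a set \<Rightarrow> bool" where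
  "Pi2_collapsible \<sigma> \<A> p S \<longleftrightarrow>
     (\<forall>m \<ge> 1. \<forall>\<phi> :: ('r, nat) prenex.
        pH_sentence \<sigma> \<phi> \<and> Pi2 \<phi> \<and> count_universal (quants \<phi>) = m \<and>
        models_adversaries \<A> \<phi> (Upsilon (carrier \<A>) m p S) \<longrightarrow> models \<A> \<phi>)"

text \<open>
  Reactive composability of the full adversary \<open>A\<^sup>m\<close>. The list \<open>Bs\<close> enumerates \<open>\<Omega>\<close>, possibly
  with repetitions, so the arity of \<open>f\<close> is not tied to the cardinality of \<open>\<Omega>\<close>. Positions are
  0-based: \<open>g i j\<close> takes the first \<open>i + 1\<close> entries.
\<close>

definition reactively_composable ::
  "'r signature \<Rightarrow> ('r, 'a) rel_structure \<Rightarrow> nat \<Rightarrow> 'a list set set \<Rightarrow> bool" where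
  "reactively_composable \<sigma> \<A> m \<Omega> \<longleftrightarrow>
     (\<exists>k Bs f. \<exists>g :: nat \<Rightarrow> nat \<Rightarrow> 'a list \<Rightarrow> 'a option.
        set Bs = \<Omega> \<and> length Bs = k \<and> polymorphism \<sigma> \<A> k f \<and>
        (\<forall>i<m. \<forall>j<k. dom (g i j) \<subseteq> tuples (carrier \<A>) (i + 1) \<and> ran (g i j) \<subseteq> carrier \<A>) \<and>
        (\<forall>a \<in> tuples (carrier \<A>) m.
           (\<forall>j<k. (\<forall>i<m. take (i + 1) a \<in> dom (g i j)) \<and>
                  map (\<lambda>i. the (g i j (take (i + 1) a))) [0..<m] \<in> Bs ! j) \<and>
           (\<forall>i<m. a ! i = f (map (\<lambda>j. the (g i j (take (i + 1) a))) [0..<k]))))"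

definition generates ::
  "'r signature \<Rightarrow> ('r, 'a) rel_structure \<Rightarrow> nat \<Rightarrow> 'a list set set \<Rightarrow> bool" where
  "generates \<sigma> \<A> m \<Omega> \<longleftrightarrow>
     (\<forall>t \<in> tuples (carrier \<A>) m. \<exists>k f ts.
        polymorphism \<sigma> \<A> k f \<and> length ts = k \<and> set ts \<subseteq> \<Union>\<Omega> \<and> t = apply_coordwise f m ts)"


section \<open>Canonical sentences\<close>

definition product_structure ::
  "'r signature \<Rightarrow> 'i set \<Rightarrow> ('i \<Rightarrow> ('r, 'a) rel_structure) \<Rightarrow> ('r, 'i \<Rightarrow> 'a) rel_structure" where
  "product_structure \<sigma> I S =
     \<lparr>carrier = (\<Pi>\<^sub>E i\<in>I. carrier (S i)),
      interp = (\<lambda>R. {es \<in> tuples (\<Pi>\<^sub>E i\<in>I. carrier (S i)) (arity \<sigma> R).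
                      \<forall>i \<in> I. map (\<lambda>e. e i) es \<in> interp (S i) R})\<rparr>"

definition consistent_maps :: "'a set \<Rightarrow> nat \<Rightarrow> nat \<Rightarrow> 'a list set \<Rightarrow> (nat \<times> nat \<Rightarrow> 'a) set" where
  "consistent_maps A n m B =
     {\<mu> \<in> ({..<n} \<times> {..<m}) \<rightarrow>\<^sub>E A.
        \<forall>l \<in> tuples {..<n} m. map (\<lambda>j. \<mu> (l ! j, j)) [0..<m] \<in> B}"

text \<open>
  The product runs over all pairs of an adversary and a map consistent with it; every factor has
  \<open>\<A>\<close> as its reduct, and the constant indexed by \<open>(i, j)\<close> is interpreted componentwise.
\<close>

definition factors ::
  "'a set \<Rightarrow> nat \<Rightarrow> nat \<Rightarrow> 'a list set set \<Rightarrow> ('a list set \<times> (nat \<times> nat \<Rightarrow> 'a)) set" where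
  "factors A n m \<Omega> = (SIGMA B:\<Omega>. consistent_maps A n m B)"

definition product_constant ::
  "'a set \<Rightarrow> nat \<Rightarrow> nat \<Rightarrow> 'a list set set \<Rightarrow> nat \<times> nat \<Rightarrow> ('a list set \<times> (nat \<times> nat \<Rightarrow> 'a) \<Rightarrow> 'a)" where
  "product_constant A n m \<Omega> ij = (\<lambda>(B, \<mu>) \<in> factors A n m \<Omega>. \<mu> ij)"

text \<open>
  Canonical query of a structure \<open>P\<close> whose elements \<open>c (i, j)\<close> for \<open>i < n\<close>, \<open>j < m\<close> are named.
  The variable \<open>Inl (i, j)\<close> stands for \<open>c (i, j)\<close>, and \<open>Inr e\<close> for an unnamed element \<open>e\<close>. If
  several \<open>c (i, j)\<close> coincide, the equality atoms identify their variables; otherwise all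
  equality atoms are trivial. The order of the existential variables is immaterial.
\<close>

definition canonical_query_sentence ::
  "'r signature \<Rightarrow> ('r, 'b) rel_structure \<Rightarrow> nat \<Rightarrow> nat \<Rightarrow> (nat \<times> nat \<Rightarrow> 'b)
     \<Rightarrow> ('r, nat \<times> nat + 'b) prenex" where
  "canonical_query_sentence \<sigma> P n m c =
     (let ws = map Inl (List.product [0..<n] [0..<m]);
          es = (SOME es. distinct es \<and> set es = Inr ` (carrier P - c ` ({..<n} \<times> {..<m})));
          V = set ws \<union> set es;
          elem = case_sum c id
      in \<lparr>quants = map (Pair Forall) ws @ map (Pair Exists) es,
          body = {Rel R vs | R vs. R \<in> symbols \<sigma> \<and> set vs \<subseteq> V \<and> map elem vs \<in> interp P R} \<union>
                 {Eq u v | u v. u \<in> V \<and> v \<in> V \<and> elem u = elem v}\<rparr>)"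

text \<open>Here \<open>m\<close> is the common length of the adversaries in \<open>\<Omega>\<close>.\<close>

definition canonical_sentence ::
  "'r signature \<Rightarrow> ('r, 'a) rel_structure \<Rightarrow> nat \<Rightarrow> nat \<Rightarrow> 'a list set set
     \<Rightarrow> ('r, nat \<times> nat + ('a list set \<times> (nat \<times> nat \<Rightarrow> 'a) \<Rightarrow> 'a)) prenex" where
  "canonical_sentence \<sigma> \<A> n m \<Omega> =
     canonical_query_sentence \<sigma>
       (product_structure \<sigma> (factors (carrier \<A>) n m \<Omega>) (\<lambda>_. \<A>)) n m
       (product_constant (carrier \<A>) n m \<Omega>)"

end

theory Submission
  imports Defs
begin

text \<open>
  The implications go round the cycle (v), (ii), (i), (iii), (iv), (v). A \<open>k\<close>-ary polymorphism is
  a homomorphism from a power of \<open>\<A>\<close>, and homomorphisms from powers indexed by arbitrary finite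
  sets compose without reindexing. Statement (v) says that every map from \<open>[n] \<times> [p + 1]\<close> to \<open>A\<close> is
  the image of the named constants under a homomorphism from the power whose index set consists of
  the consistent maps, each of which has a column that is constantly \<open>x\<close>.

  (v) to (ii): such a homomorphism for the map \<open>(i, j) \<mapsto> a\<^sub>i\<close> writes every element \<open>a\<close> as a value
  at \<open>p + 1\<close> blocks of coordinates, any one of which may be replaced by \<open>x\<close> at no cost. Applied to
  \<open>q + 1 > p\<close> free positions mapped onto the \<open>p + 1\<close> blocks, it leaves one free position fewer in each
  argument; since \<open>x\<close> is named, positions already equal to \<open>x\<close> are preserved. Descending from \<open>m\<close>
  to \<open>p\<close> gives a composition in which the entry at position \<open>i\<close> depends on \<open>a\<^sub>i\<close> alone.
  (ii) to (i): Skolem functions are composed with \<open>f\<close> and the \<open>g i j\<close>.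
  (iii) to (iv): the canonical query of the power indexed by all tuples in the adversaries is a
  \<open>\<Pi>\<^sub>2\<close>-sentence satisfied on each adversary by projections.
  (iv) to (v): a tuple of length \<open>n(p + 1)\<close> with at most \<open>p\<close> entries other than \<open>x\<close>, read as an
  \<open>n \<times> (p + 1)\<close> array, has a column that is constantly \<open>x\<close>.
\<close>

definition homomorphism ::
  "'r signature \<Rightarrow> ('r, 'b) rel_structure \<Rightarrow> ('r, 'a) rel_structure \<Rightarrow> ('b \<Rightarrow> 'a) \<Rightarrow> bool" where
  "homomorphism \<sigma> P \<A> H \<longleftrightarrow>
     (\<forall>e \<in> carrier P. H e \<in> carrier \<A>) \<and>
     (\<forall>R \<in> symbols \<sigma>. \<forall>es \<in> interp P R. map H es \<in> interp \<A> R)"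

abbreviation power_structure ::
  "'r signature \<Rightarrow> 'i set \<Rightarrow> ('r, 'a) rel_structure \<Rightarrow> ('r, 'i \<Rightarrow> 'a) rel_structure" where
  "power_structure \<sigma> I \<A> \<equiv> product_structure \<sigma> I (\<lambda>_. \<A>)"

text \<open>Members of \<open>Upsilon\<close> are indexed by their set \<open>I\<close> of free
  positions, so that freezing a position means deleting an element of \<open>I\<close>.\<close>

definition block :: "'a set \<Rightarrow> nat \<Rightarrow> 'a set \<Rightarrow> nat set \<Rightarrow> 'a list set" where
  "block A m S I = listset (map (\<lambda>i. if i \<in> I then A else S) [0..<m])"


section \<open>Adversaries\<close>

lemma in_listset_iff:
  "xs \<in> listset As \<longleftrightarrow> length xs = length As \<and> (\<forall>i < length As. xs ! i \<in> As ! i)"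
proof (induction As arbitrary: xs)
  case (Cons B As)
  show ?case
    by (cases xs) (auto simp: set_Cons_def Cons.IH All_less_Suc2)
qed auto

lemma in_tuples_iff: "t \<in> tuples A m \<longleftrightarrow> length t = m \<and> (\<forall>i < m. t ! i \<in> A)"
  by (auto simp: tuples_def set_conv_nth)

lemma finite_tuples: "finite A \<Longrightarrow> finite (tuples A m)"
  using finite_lists_length_eq[of A m] by (simp add: tuples_def conj_commute)

lemma in_block_iff:
  "t \<in> block A m S I \<longleftrightarrow> length t = m \<and> (\<forall>i < m. t ! i \<in> (if i \<in> I then A else S))"
  by (auto simp: block_def in_listset_iff)

lemma block_subset_tuples: "S \<subseteq> A \<Longrightarrow> block A m S I \<subseteq> tuples A m"
  by (force simp: in_block_iff in_tuples_iff split: if_splits)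

lemma Upsilon_eq: "Upsilon A m p S = {block A m S I | I. I \<subseteq> {..<m} \<and> card I = min p m}"
  by (simp add: Upsilon_def block_def)

lemma finite_Upsilon: "finite (Upsilon A m p S)"
proof -
  have "Upsilon A m p S = block A m S ` {I. I \<subseteq> {..<m} \<and> card I = min p m}"
    by (auto simp: Upsilon_eq)
  then show ?thesis by simp
qed

lemma Upsilon_nonempty: "Upsilon A m p S \<noteq> {}"
proof -
  have "block A m S {..<min p m} \<in> Upsilon A m p S"
    by (auto simp: Upsilon_eq)
  then show ?thesis by blast
qed

lemma Union_Upsilon_subset_tuples: "S \<subseteq> A \<Longrightarrow> \<Union> (Upsilon A m p S) \<subseteq> tuples A m"
  using block_subset_tuples by (fastforce simp: Upsilon_eq)

lemma replicate_in_Upsilon: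
  "x \<in> A \<Longrightarrow> B \<in> Upsilon A m p {x} \<Longrightarrow> replicate m x \<in> B"
  by (auto simp: Upsilon_eq in_block_iff)

text \<open>A product adversary constrains its positions independently, so consistency becomes a
  condition on columns. The index tuple that is constantly \<open>i\<close> isolates row
  \<open>i\<close>.\<close>

lemma consistent_maps_block_iff:
  assumes "n > 0" and "x \<in> A"
  shows "\<mu> \<in> consistent_maps A n m (block A m {x} I) \<longleftrightarrow>
     \<mu> \<in> ({..<n} \<times> {..<m}) \<rightarrow>\<^sub>E A \<and> (\<forall>i < n. \<forall>j < m. j \<notin> I \<longrightarrow> \<mu> (i, j) = x)"
    (is "?L \<longleftrightarrow> ?R")
proof
  assume L: ?L
  have "\<mu> (i, j) = x" if "i < n" "j < m" "j \<notin> I" for i j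
  proof -
    have "replicate m i \<in> tuples {..<n} m"
      using that by (auto simp: in_tuples_iff)
    then have "map (\<lambda>j. \<mu> (replicate m i ! j, j)) [0..<m] \<in> block A m {x} I"
      using L by (auto simp: consistent_maps_def)
    then show ?thesis
      using that by (auto simp: in_block_iff)
  qed
  then show ?R
    using L by (auto simp: consistent_maps_def)
next
  assume R: ?R
  then have "\<mu> (l ! j, j) \<in> (if j \<in> I then A else {x})" if "l \<in> tuples {..<n} m" "j < m" for l j
    using that by (auto simp: in_tuples_iff PiE_iff)
  then show ?L
    using R by (auto simp: consistent_maps_def in_block_iff)
qed

lemma consistent_maps_subset_PiE: "consistent_maps A n m B \<subseteq> ({..<n} \<times> {..<m}) \<rightarrow>\<^sub>E A"
  by (auto simp: consistent_maps_def)

lemma finite_factors: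
  assumes "finite A"
  shows "finite (factors A n m (Upsilon A m p S))"
  unfolding factors_def
proof (rule finite_SigmaI[OF finite_Upsilon])
  show "finite (consistent_maps A n m B)" for B
    using assms by (intro finite_subset[OF consistent_maps_subset_PiE] finite_PiE) auto
qed

text \<open>Every member of \<open>Upsilon\<close> contains the tuple that is constantly
  \<open>x\<close>. Hence each adversary contributes a factor to the product.\<close>

lemma const_in_consistent_maps:
  assumes "x \<in> A" and "B \<in> Upsilon A m p {x}"
  shows "(\<lambda>z\<in>{..<n} \<times> {..<m}. x) \<in> consistent_maps A n m B"
proof -
  have "map (\<lambda>j. (\<lambda>z\<in>{..<n} \<times> {..<m}. x) (l ! j, j)) [0..<m] = replicate m x"
    if "l \<in> tuples {..<n} m" for l
    using that by (intro nth_equalityI) (auto simp: in_tuples_iff)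
  then show ?thesis
    using assms replicate_in_Upsilon[OF assms] by (auto simp: consistent_maps_def)
qed

lemma factors_nonempty:
  assumes "x \<in> A"
  shows "factors A n m (Upsilon A m p {x}) \<noteq> {}"
proof -
  obtain B where "B \<in> Upsilon A m p {x}"
    using Upsilon_nonempty by blast
  then show ?thesis
    using const_in_consistent_maps[OF assms] by (fastforce simp: factors_def)
qed

lemma product_constant_apply:
  "B\<mu> \<in> factors A n m \<Omega> \<Longrightarrow> product_constant A n m \<Omega> z B\<mu> = snd B\<mu> z"
  by (simp add: product_constant_def case_prod_beta)

lemma product_constant_in_PiE:
  assumes "z \<in> {..<n} \<times> {..<m}"
  shows "product_constant A n m \<Omega> z \<in> factors A n m \<Omega> \<rightarrow>\<^sub>E A"
  using assms consistent_maps_subset_PiE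
  by (fastforce simp: product_constant_def factors_def)


section \<open>Polymorphisms as homomorphisms from powers\<close>

lemma carrier_power [simp]: "carrier (power_structure \<sigma> I \<A>) = I \<rightarrow>\<^sub>E carrier \<A>"
  by (simp add: product_structure_def)

lemma in_interp_power_iff:
  "es \<in> interp (power_structure \<sigma> I \<A>) R \<longleftrightarrow>
     es \<in> tuples (I \<rightarrow>\<^sub>E carrier \<A>) (arity \<sigma> R) \<and> (\<forall>i \<in> I. map (\<lambda>e. e i) es \<in> interp \<A> R)"
  by (simp add: product_structure_def)

lemma homomorphism_projection:
  "i \<in> I \<Longrightarrow> homomorphism \<sigma> (power_structure \<sigma> I \<A>) \<A> (\<lambda>e. e i)"
  by (auto simp: homomorphism_def in_interp_power_iff)

text \<open>Relations of a power are tested coordinatewise, so the \<open>K j\<close> together form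
  a homomorphism into the power over \<open>J\<close>, to which \<open>H\<close> applies. This is
  composition of polymorphisms without numbering their arguments.\<close>

lemma homomorphism_compose:
  assumes H: "homomorphism \<sigma> (power_structure \<sigma> J \<A>) \<A> H"
    and K: "\<And>j. j \<in> J \<Longrightarrow> homomorphism \<sigma> (power_structure \<sigma> I \<A>) \<A> (K j)"
  shows "homomorphism \<sigma> (power_structure \<sigma> I \<A>) \<A> (\<lambda>e. H (\<lambda>j\<in>J. K j e))"
proof -
  have mem: "(\<lambda>j\<in>J. K j e) \<in> J \<rightarrow>\<^sub>E carrier \<A>" if "e \<in> I \<rightarrow>\<^sub>E carrier \<A>" for e
    using K that by (auto simp: homomorphism_def)
  have "map (\<lambda>e. H (\<lambda>j\<in>J. K j e)) es \<in> interp \<A> R"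
    if R: "R \<in> symbols \<sigma>" and es: "es \<in> interp (power_structure \<sigma> I \<A>) R" for R es
  proof -
    let ?es = "map (\<lambda>e. \<lambda>j\<in>J. K j e) es"
    have "map (\<lambda>e. e j) ?es \<in> interp \<A> R" if "j \<in> J" for j
    proof -
      have "map (\<lambda>e. e j) ?es = map (K j) es"
        using that by (simp add: comp_def)
      also have "\<dots> \<in> interp \<A> R"
        using K[OF that] R es by (simp add: homomorphism_def)
      finally show ?thesis .
    qed
    moreover have "?es \<in> tuples (J \<rightarrow>\<^sub>E carrier \<A>) (arity \<sigma> R)"
      using es mem unfolding in_interp_power_iff tuples_def
      by (simp only: mem_Collect_eq length_map set_map) blast
    ultimately have "?es \<in> interp (power_structure \<sigma> J \<A>) R"
      by (simp add: in_interp_power_iff)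
    then have "map H ?es \<in> interp \<A> R"
      using H R unfolding homomorphism_def by blast
    then show ?thesis by (simp add: comp_def)
  qed
  then show ?thesis
    using H mem by (simp add: homomorphism_def)
qed

lemma homomorphism_of_polymorphism:
  assumes "polymorphism \<sigma> \<A> k f"
  shows "homomorphism \<sigma> (power_structure \<sigma> {..<k} \<A>) \<A> (\<lambda>e. f (map e [0..<k]))"
proof -
  have "map (\<lambda>e. f (map e [0..<k])) es \<in> interp \<A> R"
    if R: "R \<in> symbols \<sigma>" and es: "es \<in> interp (power_structure \<sigma> {..<k} \<A>) R" for R es
  proof -
    \<comment> \<open>The transpose of \<open>es\<close>: its \<open>j\<close>-th row holds the
      \<open>j\<close>-th coordinates.\<close>
    let ?ts = "map (\<lambda>j. map (\<lambda>e. e j) es) [0..<k]"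
    have "set ?ts \<subseteq> interp \<A> R"
      using es by (auto simp: in_interp_power_iff)
    then have "apply_coordwise f (arity \<sigma> R) ?ts \<in> interp \<A> R"
      using assms R by (simp add: polymorphism_def)
    moreover have "apply_coordwise f (arity \<sigma> R) ?ts = map (\<lambda>e. f (map e [0..<k])) es"
      using es unfolding apply_coordwise_def
      by (intro nth_equalityI) (auto simp: in_interp_power_iff in_tuples_iff comp_def
          intro!: arg_cong[of _ _ f])
    ultimately show ?thesis by simp
  qed
  moreover have "f (map e [0..<k]) \<in> carrier \<A>" if "e \<in> {..<k} \<rightarrow>\<^sub>E carrier \<A>" for e
    using assms that by (auto simp: polymorphism_def in_tuples_iff PiE_iff)
  ultimately show ?thesis
    by (simp add: homomorphism_def)
qed

text \<open>Coordinate \<open>i\<close> of the power reads argument \<open>pos i\<close>.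
  Identifying arguments and adding dummy ones preserve relations, so \<open>pos\<close> can be any
  map into the \<open>k\<close> arguments.\<close>

lemma polymorphism_of_homomorphism:
  assumes fin: "finite_structure \<sigma> \<A>"
    and H: "homomorphism \<sigma> (power_structure \<sigma> I \<A>) \<A> H"
    and pos: "\<And>i. i \<in> I \<Longrightarrow> pos i < k" and k: "k \<ge> 1"
  shows "polymorphism \<sigma> \<A> k (\<lambda>t. H (\<lambda>i\<in>I. t ! pos i))"
proof -
  have "apply_coordwise (\<lambda>t. H (\<lambda>i\<in>I. t ! pos i)) (arity \<sigma> R) ts \<in> interp \<A> R"
    if R: "R \<in> symbols \<sigma>" and ts: "length ts = k" "set ts \<subseteq> interp \<A> R" for R ts
  proof -
    let ?es = "map (\<lambda>r. \<lambda>i\<in>I. ts ! pos i ! r) [0..<arity \<sigma> R]"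
    have in_ts: "ts ! pos i \<in> interp \<A> R" if "i \<in> I" for i
      using ts pos[OF that] by auto
    then have tup: "ts ! pos i \<in> tuples (carrier \<A>) (arity \<sigma> R)" if "i \<in> I" for i
      using fin R that unfolding finite_structure_def by blast
    have "map (\<lambda>e. e i) ?es = ts ! pos i" if "i \<in> I" for i
      using tup[OF that] that by (intro nth_equalityI) (auto simp: in_tuples_iff)
    then have "?es \<in> interp (power_structure \<sigma> I \<A>) R"
      using in_ts tup by (auto simp: in_interp_power_iff in_tuples_iff)
    then have "map H ?es \<in> interp \<A> R"
      using H R unfolding homomorphism_def by blast
    moreover have "apply_coordwise (\<lambda>t. H (\<lambda>i\<in>I. t ! pos i)) (arity \<sigma> R) ts = map H ?es"
      using ts pos unfolding apply_coordwise_def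
      by (auto intro!: arg_cong[of _ _ H] restrict_ext)
    ultimately show ?thesis by simp
  qed
  moreover have "H (\<lambda>i\<in>I. t ! pos i) \<in> carrier \<A>" if "t \<in> tuples (carrier \<A>) k" for t
    using H pos that by (auto simp: homomorphism_def in_tuples_iff)
  ultimately show ?thesis
    using k by (simp add: polymorphism_def)
qed

text \<open>The constant naming \<open>x\<close> is interpreted in the power by the element that is
  constantly \<open>x\<close>, and homomorphisms preserve it.\<close>

lemma homomorphism_const:
  assumes "finite_structure \<sigma> \<A>" and "named_by_constant \<sigma> \<A> x"
    and H: "homomorphism \<sigma> (power_structure \<sigma> I \<A>) \<A> H"
  shows "H (\<lambda>i\<in>I. x) = x"
proof -
  obtain c where c: "c \<in> symbols \<sigma>" "arity \<sigma> c = 1" "interp \<A> c = {[x]}"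
    using assms by (auto simp: named_by_constant_def)
  then have "x \<in> carrier \<A>"
    using assms by (fastforce simp: finite_structure_def tuples_def)
  then have "[\<lambda>i\<in>I. x] \<in> interp (power_structure \<sigma> I \<A>) c"
    using c by (simp add: in_interp_power_iff in_tuples_iff)
  then have "map H [\<lambda>i\<in>I. x] \<in> interp \<A> c"
    using H c(1) unfolding homomorphism_def by blast
  then show ?thesis using c(3) by simp
qed


section \<open>Canonical queries\<close>

text \<open>The positive diagram of \<open>P\<close>, with variable \<open>v\<close> as a name for
  \<open>elem v\<close>. Names need not be unique; the equality atoms record which of them
  coincide.\<close>

definition diagram ::
  "'r signature \<Rightarrow> ('r, 'b) rel_structure \<Rightarrow> 'v set \<Rightarrow> ('v \<Rightarrow> 'b) \<Rightarrow> ('r, 'v) atom set" where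
  "diagram \<sigma> P V elem =
     {Rel R vs | R vs. R \<in> symbols \<sigma> \<and> set vs \<subseteq> V \<and> map elem vs \<in> interp P R} \<union>
     {Eq u v | u v. u \<in> V \<and> v \<in> V \<and> elem u = elem v}"

lemma diagram_vars: "\<alpha> \<in> diagram \<sigma> P V elem \<Longrightarrow> atom_vars \<alpha> \<subseteq> V"
  by (auto simp: diagram_def)

lemma homomorphism_satisfies_diagram:
  assumes "homomorphism \<sigma> P \<A> H" and "\<alpha> \<in> diagram \<sigma> P V elem"
    and e: "\<And>v. v \<in> V \<Longrightarrow> e v = H (elem v)"
  shows "atom_holds \<A> e \<alpha>"
proof -
  have "map e vs \<in> interp \<A> R"
    if "R \<in> symbols \<sigma>" "set vs \<subseteq> V" "map elem vs \<in> interp P R" for R vs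
  proof -
    have "map H (map elem vs) \<in> interp \<A> R"
      using assms(1) that unfolding homomorphism_def by blast
    moreover have "map e vs = map H (map elem vs)"
      using that(2) e by auto
    ultimately show ?thesis by (simp only:)
  qed
  then show ?thesis
    using assms(2) e by (auto simp: diagram_def)
qed

text \<open>Sending each element to the value of a chosen name is a homomorphism by the relational
  atoms, and the equality atoms make the value independent of the choice. Surjectivity supplies a
  name for every element.\<close>

lemma homomorphism_of_diagram:
  assumes sat: "\<forall>\<alpha> \<in> diagram \<sigma> P V elem. atom_holds \<A> e \<alpha>"
    and surj: "elem ` V = carrier P"
    and P: "\<And>R es. R \<in> symbols \<sigma> \<Longrightarrow> es \<in> interp P R \<Longrightarrow> set es \<subseteq> carrier P"
    and e: "\<And>v. v \<in> V \<Longrightarrow> e v \<in> carrier \<A>"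
  shows "\<exists>H. homomorphism \<sigma> P \<A> H \<and> (\<forall>v \<in> V. H (elem v) = e v)"
proof -
  define r where "r = inv_into V elem"
  have r: "r b \<in> V" "elem (r b) = b" if "b \<in> carrier P" for b
    using that surj by (auto simp: r_def inv_into_into f_inv_into_f)
  have "map (e \<circ> r) es \<in> interp \<A> R" if R: "R \<in> symbols \<sigma>" and es: "es \<in> interp P R" for R es
  proof -
    have sub: "set es \<subseteq> carrier P" using P[OF R es] .
    then have "map elem (map r es) = es"
      using r by (auto intro!: map_idI)
    moreover have "set (map r es) \<subseteq> V"
      using sub r by auto
    ultimately have "Rel R (map r es) \<in> diagram \<sigma> P V elem"
      using R es by (auto simp: diagram_def)
    then show ?thesis using sat by fastforce
  qed
  then have "homomorphism \<sigma> P \<A> (e \<circ> r)"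
    using r e by (auto simp: homomorphism_def)
  moreover have "(e \<circ> r) (elem v) = e v" if "v \<in> V" for v
  proof -
    have "Eq (r (elem v)) v \<in> diagram \<sigma> P V elem"
      using that surj r[of "elem v"] by (auto simp: diagram_def)
    then show ?thesis using sat by fastforce
  qed
  ultimately show ?thesis by blast
qed

section \<open>Quantifier blocks as single assignments\<close>

lemma override_on_fun_upd:
  "override_on (e(u := h u)) h S = override_on e h (insert u S)"
  by (auto simp: override_on_def)

lemma override_on_fun_upd':
  "u \<notin> S \<Longrightarrow> override_on (e(u := a)) h S = override_on e (h(u := a)) (insert u S)"
  by (auto simp: override_on_def)

lemma sat_prefix_Forall:
  "distinct us \<Longrightarrow> sat_prefix \<A> (map (Pair Forall) us @ qs) \<Gamma> e \<longleftrightarrow>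
     (\<forall>h. (\<forall>u \<in> set us. h u \<in> carrier \<A>) \<longrightarrow> sat_prefix \<A> qs \<Gamma> (override_on e h (set us)))"
proof (induction us arbitrary: e)
  case (Cons u us)
  have "sat_prefix \<A> (map (Pair Forall) (u # us) @ qs) \<Gamma> e \<longleftrightarrow>
      (\<forall>a \<in> carrier \<A>. \<forall>h. (\<forall>u \<in> set us. h u \<in> carrier \<A>) \<longrightarrow>
         sat_prefix \<A> qs \<Gamma> (override_on (e(u := a)) h (set us)))" (is "_ \<longleftrightarrow> ?L")
    using Cons.prems by (simp only: list.map append_Cons sat_prefix.simps Cons.IH distinct.simps)
  also have "?L \<longleftrightarrow> (\<forall>h. (\<forall>u \<in> set (u # us). h u \<in> carrier \<A>) \<longrightarrow>
      sat_prefix \<A> qs \<Gamma> (override_on e h (set (u # us))))" (is "_ \<longleftrightarrow> ?R")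
  proof
    assume L: ?L
    show ?R
    proof (intro allI impI)
      fix h assume "\<forall>u \<in> set (u # us). h u \<in> carrier \<A>"
      then show "sat_prefix \<A> qs \<Gamma> (override_on e h (set (u # us)))"
        using L[rule_format, of "h u" h] by (simp add: override_on_fun_upd)
    qed
  next
    assume R: ?R
    show ?L
    proof (intro allI impI ballI)
      fix a h assume "a \<in> carrier \<A>" "\<forall>u \<in> set us. h u \<in> carrier \<A>"
      then have "\<forall>v \<in> set (u # us). (h(u := a)) v \<in> carrier \<A>"
        by simp
      then show "sat_prefix \<A> qs \<Gamma> (override_on (e(u := a)) h (set us))"
        using R Cons.prems override_on_fun_upd'[of u "set us"] by (metis distinct.simps(2) list.simps(15))
    qed
  qed
  finally show ?case .
qed auto

lemma sat_prefix_Exists: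
  "distinct us \<Longrightarrow> sat_prefix \<A> (map (Pair Exists) us @ qs) \<Gamma> e \<longleftrightarrow>
     (\<exists>h. (\<forall>u \<in> set us. h u \<in> carrier \<A>) \<and> sat_prefix \<A> qs \<Gamma> (override_on e h (set us)))"
proof (induction us arbitrary: e)
  case (Cons u us)
  have "sat_prefix \<A> (map (Pair Exists) (u # us) @ qs) \<Gamma> e \<longleftrightarrow>
      (\<exists>a \<in> carrier \<A>. \<exists>h. (\<forall>u \<in> set us. h u \<in> carrier \<A>) \<and>
         sat_prefix \<A> qs \<Gamma> (override_on (e(u := a)) h (set us)))" (is "_ \<longleftrightarrow> ?L")
    using Cons.prems by (simp only: list.map append_Cons sat_prefix.simps Cons.IH distinct.simps)
  also have "?L \<longleftrightarrow> (\<exists>h. (\<forall>u \<in> set (u # us). h u \<in> carrier \<A>) \<and>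
      sat_prefix \<A> qs \<Gamma> (override_on e h (set (u # us))))" (is "_ \<longleftrightarrow> ?R")
  proof
    assume ?L
    then obtain a h where "a \<in> carrier \<A>" "\<forall>u \<in> set us. h u \<in> carrier \<A>"
      "sat_prefix \<A> qs \<Gamma> (override_on (e(u := a)) h (set us))"
      by blast
    then show ?R
      using Cons.prems by (intro exI[of _ "h(u := a)"]) (auto simp: override_on_fun_upd')
  next
    assume ?R
    then obtain h where "\<forall>u \<in> set (u # us). h u \<in> carrier \<A>"
      "sat_prefix \<A> qs \<Gamma> (override_on e h (set (u # us)))"
      by blast
    then show ?L
      by (intro bexI[of _ "h u"] exI[of _ h]) (auto simp: override_on_fun_upd)
  qed
  finally show ?case .
qed auto

text \<open>Satisfying assignments of the positive diagram are the homomorphisms from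
  \<open>P\<close> composed with \<open>elem\<close>, the classical correspondence for canonical
  queries. The universal block prescribes values on the elements it names, and the existential block
  asks for an extension.\<close>

lemma models_diagram_iff:
  fixes \<phi> :: "('r, 'v) prenex" and \<A> :: "('r, 'a) rel_structure"
  assumes quants: "quants \<phi> = map (Pair Forall) us @ map (Pair Exists) es"
    and dist: "distinct (us @ es)"
    and body: "body \<phi> = diagram \<sigma> P (set us \<union> set es) elem"
    and surj: "elem ` (set us \<union> set es) = carrier P"
    and P: "\<And>R es. R \<in> symbols \<sigma> \<Longrightarrow> es \<in> interp P R \<Longrightarrow> set es \<subseteq> carrier P"
  shows "models \<A> \<phi> \<longleftrightarrow>
     (\<forall>h. (\<forall>u \<in> set us. h u \<in> carrier \<A>) \<longrightarrow>
        (\<exists>H. homomorphism \<sigma> P \<A> H \<and> (\<forall>u \<in> set us. H (elem u) = h u)))"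
    (is "?L \<longleftrightarrow> ?R")
proof -
  \<comment> \<open>All variables of the body lie in one of the two blocks, so the background value
    \<open>undefined\<close> is never read.\<close>
  let ?env = "\<lambda>(h :: 'v \<Rightarrow> 'a) g. override_on (override_on (\<lambda>_. undefined) h (set us)) g (set es)"
  have L: "?L \<longleftrightarrow> (\<forall>h. (\<forall>u \<in> set us. h u \<in> carrier \<A>) \<longrightarrow>
      (\<exists>g. (\<forall>u \<in> set es. g u \<in> carrier \<A>) \<and> (\<forall>\<alpha> \<in> body \<phi>. atom_holds \<A> (?env h g) \<alpha>)))"
    using dist
    by (simp add: models_def quants sat_prefix_Forall sat_prefix_Exists[where qs = "[]", simplified])
  have env_us: "?env h g u = h u" if "u \<in> set us" for h g u
    using that dist by (auto simp: override_on_def)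
  have env_es: "?env h g u = g u" if "u \<in> set es" for h g u
    using that by (auto simp: override_on_def)
  show ?thesis
  proof
    assume ?L
    show ?R
    proof (intro allI impI)
      fix h assume h: "\<forall>u \<in> set us. h u \<in> carrier \<A>"
      then obtain g where g: "\<forall>u \<in> set es. g u \<in> carrier \<A>"
        "\<forall>\<alpha> \<in> body \<phi>. atom_holds \<A> (?env h g) \<alpha>"
        using \<open>?L\<close> L by blast
      have env: "?env h g v \<in> carrier \<A>" if "v \<in> set us \<union> set es" for v
        using that h g(1) env_us env_es by (metis Un_iff)
      have "\<exists>H. homomorphism \<sigma> P \<A> H \<and> (\<forall>v \<in> set us \<union> set es. H (elem v) = ?env h g v)"
        by (rule homomorphism_of_diagram[OF g(2)[unfolded body] surj]) (erule (1) P, erule env)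
      then show "\<exists>H. homomorphism \<sigma> P \<A> H \<and> (\<forall>u \<in> set us. H (elem u) = h u)"
        using env_us by (metis UnI1)
    qed
  next
    assume R: ?R
    show ?L
      unfolding L
    proof (intro allI impI)
      fix h assume "\<forall>u \<in> set us. h u \<in> carrier \<A>"
      then obtain H where H: "homomorphism \<sigma> P \<A> H" "\<forall>u \<in> set us. H (elem u) = h u"
        using R by blast
      have "?env h (H \<circ> elem) v = H (elem v)" if "v \<in> set us \<union> set es" for v
        using that H(2) env_us env_es by (metis Un_iff comp_apply)
      then have "\<forall>\<alpha> \<in> body \<phi>. atom_holds \<A> (?env h (H \<circ> elem)) \<alpha>"
        using homomorphism_satisfies_diagram[OF H(1)] body by metis
      moreover have "\<forall>u \<in> set es. (H \<circ> elem) u \<in> carrier \<A>"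
        using H(1) surj by (auto simp: homomorphism_def)
      ultimately show "\<exists>g. (\<forall>u \<in> set es. g u \<in> carrier \<A>) \<and>
          (\<forall>\<alpha> \<in> body \<phi>. atom_holds \<A> (?env h g) \<alpha>)"
        by blast
    qed
  qed
qed

lemma models_canonical_sentence_iff:
  assumes "finite (carrier \<A>)" and "finite (factors (carrier \<A>) n m \<Omega>)"
  shows "models \<A> (canonical_sentence \<sigma> \<A> n m \<Omega>) \<longleftrightarrow>
     (\<forall>h. (\<forall>z \<in> {..<n} \<times> {..<m}. h z \<in> carrier \<A>) \<longrightarrow>
        (\<exists>H. homomorphism \<sigma> (power_structure \<sigma> (factors (carrier \<A>) n m \<Omega>) \<A>) \<A> H \<and>
             (\<forall>z \<in> {..<n} \<times> {..<m}. H (product_constant (carrier \<A>) n m \<Omega> z) = h z)))"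
proof -
  let ?P = "power_structure \<sigma> (factors (carrier \<A>) n m \<Omega>) \<A>"
  let ?c = "product_constant (carrier \<A>) n m \<Omega>"
  let ?Z = "{..<n} \<times> {..<m}"
  define es where "es = (SOME es. distinct es \<and> set es =
      (Inr :: _ \<Rightarrow> nat \<times> nat + _) ` (carrier ?P - ?c ` ?Z))"
  define ws :: "(nat \<times> nat + ('a list set \<times> (nat \<times> nat \<Rightarrow> 'a) \<Rightarrow> 'a)) list"
    where "ws = map Inl (List.product [0..<n] [0..<m])"
  \<comment> \<open>A finite set of unnamed elements has an enumeration, which gives the choice made
    in the canonical sentence its intended meaning.\<close>
  have "finite ((Inr :: _ \<Rightarrow> nat \<times> nat + _) ` (carrier ?P - ?c ` ?Z))"
    using assms by (auto intro: finite_PiE)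
  then have "\<exists>es. distinct es \<and> set es = (Inr :: _ \<Rightarrow> nat \<times> nat + _) ` (carrier ?P - ?c ` ?Z)"
    using finite_distinct_list by metis
  then have "distinct es \<and> set es = Inr ` (carrier ?P - ?c ` ?Z)"
    unfolding es_def by (rule someI_ex)
  then have es: "distinct es" "set es = Inr ` (carrier ?P - ?c ` ?Z)"
    by simp_all
  have ws: "distinct ws" "set ws = Inl ` ?Z"
    by (auto simp: ws_def distinct_map distinct_product atLeast0LessThan)
  have c: "?c z \<in> carrier ?P" if "z \<in> ?Z" for z
    using product_constant_in_PiE[OF that] by simp
  have "models \<A> (canonical_sentence \<sigma> \<A> n m \<Omega>) \<longleftrightarrow>
     (\<forall>h. (\<forall>u \<in> set ws. h u \<in> carrier \<A>) \<longrightarrow>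
        (\<exists>H. homomorphism \<sigma> ?P \<A> H \<and> (\<forall>u \<in> set ws. H (case_sum ?c id u) = h u)))"
  proof (rule models_diagram_iff)
    show "quants (canonical_sentence \<sigma> \<A> n m \<Omega>) = map (Pair Forall) ws @ map (Pair Exists) es"
      by (simp add: canonical_sentence_def canonical_query_sentence_def Let_def ws_def es_def)
    show "body (canonical_sentence \<sigma> \<A> n m \<Omega>) =
        diagram \<sigma> ?P (set ws \<union> set es) (case_sum ?c id)"
      by (simp add: canonical_sentence_def canonical_query_sentence_def Let_def ws_def es_def
          diagram_def)
    show "distinct (ws @ es)"
      using es ws by auto
    show "case_sum ?c id ` (set ws \<union> set es) = carrier ?P"
      unfolding es ws image_Un image_image using c by auto
  qed (auto simp: in_interp_power_iff tuples_def)
  also have "\<dots> \<longleftrightarrow> (\<forall>h. (\<forall>z \<in> ?Z. h z \<in> carrier \<A>) \<longrightarrow>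
        (\<exists>H. homomorphism \<sigma> ?P \<A> H \<and> (\<forall>z \<in> ?Z. H (?c z) = h z)))" (is "?L \<longleftrightarrow> ?R")
  proof
    assume L: ?L
    show ?R
    proof (intro allI impI)
      fix h assume "\<forall>z \<in> ?Z. h z \<in> carrier \<A>"
      \<comment> \<open>\<open>ws\<close> consists of \<open>Inl\<close> variables only, so the
        branch \<open>undefined\<close> is a filler.\<close>
      then have "\<forall>u \<in> set ws. case_sum h undefined u \<in> carrier \<A>"
        unfolding ws by auto
      then show "\<exists>H. homomorphism \<sigma> ?P \<A> H \<and> (\<forall>z \<in> ?Z. H (?c z) = h z)"
        using L unfolding ws by fastforce
    qed
  next
    assume R: ?R
    show ?L
    proof (intro allI impI)
      fix h assume "\<forall>u \<in> set ws. h u \<in> carrier \<A>"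
      then show "\<exists>H. homomorphism \<sigma> ?P \<A> H \<and> (\<forall>u \<in> set ws. H (case_sum ?c id u) = h u)"
        using R[rule_format, of "h \<circ> Inl"] unfolding ws by auto
    qed
  qed
  finally show ?thesis .
qed

section \<open>Reactive composition\<close>

lemma count_universal_simps [simp]:
  "count_universal [] = 0"
  "count_universal ((q, v) # qs) = (if q = Forall then 1 else 0) + count_universal qs"
  "count_universal (qs @ qs') = count_universal qs + count_universal qs'"
  "count_universal (map (Pair Forall) vs) = length vs"
  "count_universal (map (Pair Exists) vs) = 0"
  by (auto simp: count_universal_def comp_def)

lemma universals_before_append:
  assumes "quants \<phi> = pre @ (q, v) # post" and "distinct (map snd (quants \<phi>))"
  shows "universals_before \<phi> v = count_universal pre"
proof -
  have "\<forall>a \<in> set pre. (\<lambda>(q, w). w \<noteq> v) a"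
    using assms by (auto simp: rev_image_eqI)
  then have "takeWhile (\<lambda>(q, w). w \<noteq> v) (quants \<phi>) = pre"
    by (simp add: assms(1) takeWhile_append2)
  then show ?thesis by (simp add: universals_before_def)
qed

lemma universals_before_le: "universals_before \<phi> v \<le> count_universal (quants \<phi>)"
  using takeWhile_dropWhile_id[of "\<lambda>(q, w). w \<noteq> v" "quants \<phi>"] count_universal_simps(3)
  unfolding universals_before_def by (metis le_add1)

text \<open>For showing that the value of a variable in \<open>pre\<close> under
  \<open>skolem_env\<close> does not change when the tuple of universal values is extended. A
  universal variable of \<open>pre\<close> is itself counted there, which makes its bound
  strict.\<close>

lemma universals_before_prefix:
  assumes quants: "quants \<phi> = pre @ qs" and dist: "distinct (map snd (quants \<phi>))"
    and v: "v \<in> snd ` set pre"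
  shows "universals_before \<phi> v \<le> count_universal pre"
    and "(Forall, v) \<in> set (quants \<phi>) \<Longrightarrow> universals_before \<phi> v < count_universal pre"
proof -
  obtain q p1 p2 where pre: "pre = p1 @ (q, v) # p2"
    using v by (auto dest: split_list)
  have ub: "universals_before \<phi> v = count_universal p1"
    using quants pre by (intro universals_before_append[OF _ dist, of p1 q v "p2 @ qs"]) simp
  then show "universals_before \<phi> v \<le> count_universal pre"
    by (simp add: pre)
  show "universals_before \<phi> v < count_universal pre" if "(Forall, v) \<in> set (quants \<phi>)"
  proof -
    have "(q, v) \<in> set (quants \<phi>)"
      by (simp add: quants pre)
    then have "q = Forall"
      using that dist by (force simp: distinct_map inj_on_def)
    then show ?thesis by (simp add: ub pre)
  qed
qed

section \<open>Playing Skolem functions against all universal choices\<close>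

lemma atom_holds_cong:
  "(\<And>v. v \<in> atom_vars \<alpha> \<Longrightarrow> e v = e' v) \<Longrightarrow> atom_holds \<A> e \<alpha> \<longleftrightarrow> atom_holds \<A> e' \<alpha>"
  by (cases \<alpha>) (auto cong: map_cong)

text \<open>The Skolem functions form a winning strategy: along the prefix, each existential
  variable is answered by its Skolem function applied to the universal choices made so far.\<close>

lemma models_if_models_full_adversary:
  assumes pH: "pH_sentence \<sigma> \<phi>"
    and adv: "models_adversary \<A> \<phi> (tuples (carrier \<A>) (count_universal (quants \<phi>)))"
  shows "models \<A> \<phi>"
proof -
  have dist: "distinct (map snd (quants \<phi>))"
    using pH by (simp add: pH_sentence_def)
  obtain s where s: "\<And>v t. t \<in> tuples (carrier \<A>) (universals_before \<phi> v) \<Longrightarrow> s v t \<in> carrier \<A>"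
    and sat: "\<And>t \<alpha>. t \<in> tuples (carrier \<A>) (count_universal (quants \<phi>)) \<Longrightarrow> \<alpha> \<in> body \<phi> \<Longrightarrow>
      atom_holds \<A> (skolem_env \<phi> s t) \<alpha>"
    using adv unfolding models_adversary_def by blast
  \<comment> \<open>The invariant: \<open>pre\<close> has been processed, \<open>t\<close> lists the
    universal choices so far, and \<open>e\<close> agrees with \<open>skolem_env\<close> on the
    variables already bound. Later variables, for which \<open>t\<close> may be too short, are not
    compared.\<close>
  have "sat_prefix \<A> qs (body \<phi>) e"
    if "quants \<phi> = pre @ qs" and "t \<in> tuples (carrier \<A>) (count_universal pre)"
      and "\<And>v. v \<in> snd ` set pre \<Longrightarrow> e v = skolem_env \<phi> s t v" for pre qs t e
    using that
  proof (induction qs arbitrary: pre t e)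
    case Nil
    have "atom_holds \<A> e \<alpha>" if "\<alpha> \<in> body \<phi>" for \<alpha>
    proof -
      have "atom_vars \<alpha> \<subseteq> snd ` set pre"
        using pH that Nil.prems(1) by (simp add: pH_sentence_def)
      then have "atom_holds \<A> e \<alpha> \<longleftrightarrow> atom_holds \<A> (skolem_env \<phi> s t) \<alpha>"
        using Nil.prems(3) by (intro atom_holds_cong) blast
      then show ?thesis
        using sat that Nil.prems by simp
    qed
    then show ?case by simp
  next
    case (Cons qv qs)
    obtain q v where qv: "qv = (q, v)" by force
    have ub: "universals_before \<phi> v = count_universal pre"
      using Cons.prems(1) qv by (intro universals_before_append[OF _ dist]) simp
    have len: "length t = count_universal pre"
      using Cons.prems(2) by (simp add: in_tuples_iff)
    have qv_in: "(q, v) \<in> set (quants \<phi>)"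
      using Cons.prems(1) qv by simp
    have fresh: "v \<notin> snd ` set pre"
      using dist Cons.prems(1) qv by auto
    show ?case
    proof (cases q)
      case Forall
      have "sat_prefix \<A> qs (body \<phi>) (e(v := a))" if a: "a \<in> carrier \<A>" for a
      proof (rule Cons.IH[of "pre @ [(q, v)]" "t @ [a]"])
        show "t @ [a] \<in> tuples (carrier \<A>) (count_universal (pre @ [(q, v)]))"
          using a Cons.prems(2) Forall by (auto simp: tuples_def)
        show "(e(v := a)) w = skolem_env \<phi> s (t @ [a]) w" if "w \<in> snd ` set (pre @ [(q, v)])" for w
        proof (cases "w = v")
          case True
          then show ?thesis
            using qv_in Forall ub len by (simp add: skolem_env_def nth_append)
        next
          case False
          then have w: "w \<in> snd ` set pre" using that by auto
          have "skolem_env \<phi> s (t @ [a]) w = skolem_env \<phi> s t w"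
            using universals_before_prefix[OF Cons.prems(1) dist w] len
            by (auto simp: skolem_env_def nth_append)
          then show ?thesis
            using False Cons.prems(3)[OF w] by simp
        qed
      qed (use Cons.prems(1) qv in simp)
      then show ?thesis by (simp add: qv Forall)
    next
      case Exists
      have "(Forall, v) \<notin> set (quants \<phi>)"
        using qv_in Exists dist by (force simp: distinct_map inj_on_def)
      then have env: "skolem_env \<phi> s t v = s v t"
        using ub len by (simp add: skolem_env_def)
      have "sat_prefix \<A> qs (body \<phi>) (e(v := s v t))"
      proof (rule Cons.IH[of "pre @ [(q, v)]" t])
        show "t \<in> tuples (carrier \<A>) (count_universal (pre @ [(q, v)]))"
          using Cons.prems(2) Exists by simp
        show "(e(v := s v t)) w = skolem_env \<phi> s t w" if "w \<in> snd ` set (pre @ [(q, v)])" for w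
          using that env Cons.prems(3) fresh by auto
      qed (use Cons.prems(1) qv in simp)
      moreover have "s v t \<in> carrier \<A>"
        using s ub Cons.prems(2) by simp
      ultimately show ?thesis
        using qv Exists by auto
    qed
  qed
  from this[of "[]" "quants \<phi>" "[]"] show ?thesis
    by (simp add: models_def in_tuples_iff)
qed

text \<open>A play \<open>a\<close> is answered by running \<open>k\<close> plays in parallel, the
  \<open>j\<close>-th one inside the adversary \<open>Bs ! j\<close> with Skolem functions for that
  adversary, and merging the answers by \<open>f\<close>. The body survives because \<open>f\<close>
  is a polymorphism.\<close>

lemma models_full_adversary_if_composable:
  fixes \<A> :: "('r, 'a) rel_structure"
  assumes fin: "finite_structure \<sigma> \<A>" and pH: "pH_sentence \<sigma> \<phi>"
    and m: "count_universal (quants \<phi>) = m"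
    and comp: "reactively_composable \<sigma> \<A> m \<Omega>"
    and adv: "models_adversaries \<A> \<phi> \<Omega>"
  shows "models_adversary \<A> \<phi> (tuples (carrier \<A>) m)"
proof -
  let ?A = "carrier \<A>"
  have dist: "distinct (map snd (quants \<phi>))"
    using pH by (simp add: pH_sentence_def)
  obtain x where x: "x \<in> ?A"
    using fin by (auto simp: finite_structure_def)
  obtain k Bs f and g :: "nat \<Rightarrow> nat \<Rightarrow> 'a list \<Rightarrow> 'a option"
    where Bs: "set Bs = \<Omega>" "length Bs = k" and f: "polymorphism \<sigma> \<A> k f"
      and dom_ran: "\<forall>i<m. \<forall>j<k. dom (g i j) \<subseteq> tuples ?A (i + 1) \<and> ran (g i j) \<subseteq> ?A"
      and comp': "\<forall>a \<in> tuples ?A m.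
           (\<forall>j<k. (\<forall>i<m. take (i + 1) a \<in> dom (g i j)) \<and>
                  map (\<lambda>i. the (g i j (take (i + 1) a))) [0..<m] \<in> Bs ! j) \<and>
           (\<forall>i<m. a ! i = f (map (\<lambda>j. the (g i j (take (i + 1) a))) [0..<k]))"
    using comp unfolding reactively_composable_def by (elim exE conjE) (rule that)
  have ran: "ran (g i j) \<subseteq> ?A" if "i < m" "j < k" for i j
    using dom_ran that by simp
  have dom: "take (i + 1) a \<in> dom (g i j)" if "a \<in> tuples ?A m" "i < m" "j < k" for a i j
    using comp'[rule_format, OF that(1)] that(2,3) by blast
  have mem: "map (\<lambda>i. the (g i j (take (i + 1) a))) [0..<m] \<in> Bs ! j"
    if "a \<in> tuples ?A m" "j < k" for a j
    using comp'[rule_format, OF that(1)] that(2) by blast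
  have fg: "a ! i = f (map (\<lambda>j. the (g i j (take (i + 1) a))) [0..<k])"
    if "a \<in> tuples ?A m" "i < m" for a i
    using comp'[rule_format, OF that(1)] that(2) by blast
  have "\<forall>B \<in> \<Omega>. \<exists>s. (\<forall>v. \<forall>t \<in> tuples ?A (universals_before \<phi> v). s v t \<in> ?A) \<and>
      (\<forall>t \<in> B. \<forall>\<alpha> \<in> body \<phi>. atom_holds \<A> (skolem_env \<phi> s t) \<alpha>)"
    using adv by (simp add: models_adversaries_def models_adversary_def)
  then obtain S where S: "\<And>B v t. B \<in> \<Omega> \<Longrightarrow> t \<in> tuples ?A (universals_before \<phi> v) \<Longrightarrow> S B v t \<in> ?A"
    and S_sat: "\<And>B t \<alpha>. B \<in> \<Omega> \<Longrightarrow> t \<in> B \<Longrightarrow> \<alpha> \<in> body \<phi> \<Longrightarrow>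
        atom_holds \<A> (skolem_env \<phi> (S B) t) \<alpha>"
    by metis
  have B_in: "Bs ! j \<in> \<Omega>" if "j < k" for j
    using that Bs by auto
  \<comment> \<open>\<open>d j\<close> turns a partial play into a partial play for the
    \<open>j\<close>-th adversary, which is possible because \<open>g i j\<close> sees only the
    first \<open>i + 1\<close> entries.\<close>
  define d where "d = (\<lambda>j t. map (\<lambda>i. the (g i j (take (i + 1) t))) [0..<length t])"
  have d_tuples: "d j t \<in> tuples ?A i" if t: "t \<in> tuples ?A i" and "i \<le> m" "j < k" for i j t
  proof -
    \<comment> \<open>Definedness of the \<open>g i j\<close> is given along complete plays, hence
      the padding by an arbitrary element.\<close>
    let ?a = "t @ replicate (m - i) x"
    have a: "?a \<in> tuples ?A m"
      using t x \<open>i \<le> m\<close> by (auto simp: tuples_def)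
    have "the (g i' j (take (i' + 1) t)) \<in> ?A" if "i' < i" for i'
    proof -
      have "i' < m"
        using that \<open>i \<le> m\<close> by simp
      have "take (i' + 1) ?a = take (i' + 1) t"
        using that t by (simp add: in_tuples_iff)
      then have "take (i' + 1) t \<in> dom (g i' j)"
        using dom[OF a \<open>i' < m\<close> \<open>j < k\<close>] by metis
      then obtain y where "g i' j (take (i' + 1) t) = Some y"
        by blast
      then show ?thesis
        using ran[OF \<open>i' < m\<close> \<open>j < k\<close>] by (auto simp: ran_def)
    qed
    then show ?thesis
      using t by (auto simp: d_def in_tuples_iff)
  qed
  \<comment> \<open>Reactivity in the form needed: transforming a play commutes with cutting it off,
    so the merged answers depend only on entries already played.\<close>
  have d_take: "d j (take i t) = take i (d j t)" for i j t
    by (auto simp: d_def take_map min_def intro!: nth_equalityI)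
  have d_full: "d j a \<in> Bs ! j" if "a \<in> tuples ?A m" "j < k" for a j
    using mem[OF that] that by (simp add: d_def in_tuples_iff)
  have d_nth: "a ! i = f (map (\<lambda>j. d j a ! i) [0..<k])" if "a \<in> tuples ?A m" "i < m" for a i
    using fg[OF that] that by (simp add: d_def in_tuples_iff)
  define s where "s = (\<lambda>v t. f (map (\<lambda>j. S (Bs ! j) v (d j t)) [0..<k]))"
  have s: "s v t \<in> ?A" if "t \<in> tuples ?A (universals_before \<phi> v)" for v t
  proof -
    have "d j t \<in> tuples ?A (universals_before \<phi> v)" if "j < k" for j
      using d_tuples that \<open>t \<in> _\<close> universals_before_le[of \<phi> v] m by blast
    then have "map (\<lambda>j. S (Bs ! j) v (d j t)) [0..<k] \<in> tuples ?A k"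
      using S B_in by (simp add: in_tuples_iff)
    then show ?thesis
      using f by (simp add: s_def polymorphism_def)
  qed
  have sat: "atom_holds \<A> (skolem_env \<phi> s a) \<alpha>"
    if a: "a \<in> tuples ?A m" and \<alpha>: "\<alpha> \<in> body \<phi>" for a \<alpha>
  proof -
    let ?env = "\<lambda>j. skolem_env \<phi> (S (Bs ! j)) (d j a)"
    \<comment> \<open>On universal variables this is the composition equation for \<open>a\<close>;
      on the others it is the definition of \<open>s\<close> together with
      \<open>d_take\<close>.\<close>
    have env: "skolem_env \<phi> s a v = f (map (\<lambda>j. ?env j v) [0..<k])" for v
    proof (cases "(Forall, v) \<in> set (quants \<phi>)")
      case True
      then have "universals_before \<phi> v < m"
        using universals_before_prefix(2)[of \<phi> "quants \<phi>" "[]" v] dist m by (force simp: rev_image_eqI)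
      then show ?thesis
        using True d_nth[OF a] by (simp add: skolem_env_def)
    next
      case False
      then show ?thesis by (simp add: skolem_env_def s_def d_take)
    qed
    have sat: "atom_holds \<A> (?env j) \<alpha>" if "j < k" for j
      using S_sat B_in d_full a \<alpha> that by blast
    show ?thesis
    proof (cases \<alpha>)
      case (Rel R vs)
      then have R: "R \<in> symbols \<sigma>" "length vs = arity \<sigma> R"
        using pH \<alpha> by (fastforce simp: pH_sentence_def)+
      let ?ts = "map (\<lambda>j. map (?env j) vs) [0..<k]"
      have "length ?ts = k \<and> set ?ts \<subseteq> interp \<A> R"
        using sat Rel by auto
      then have "apply_coordwise f (arity \<sigma> R) ?ts \<in> interp \<A> R"
        using f R unfolding polymorphism_def by blast
      moreover have "apply_coordwise f (arity \<sigma> R) ?ts = map (skolem_env \<phi> s a) vs"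
        using R by (intro nth_equalityI) (auto simp: apply_coordwise_def env comp_def)
      ultimately show ?thesis by (simp add: Rel)
    next
      case (Eq u v)
      then have "map (\<lambda>j. ?env j u) [0..<k] = map (\<lambda>j. ?env j v) [0..<k]"
        using sat by auto
      then show ?thesis by (simp only: Eq env atom_holds.simps)
    qed
  qed
  show ?thesis
    unfolding models_adversary_def
    by (intro exI[of _ s] conjI allI ballI) (erule s, erule (1) sat)
qed

lemma collapsible_if_composable:
  assumes "finite_structure \<sigma> \<A>"
    and "\<forall>m \<ge> 1. reactively_composable \<sigma> \<A> m (Upsilon (carrier \<A>) m p S)"
  shows "collapsible \<sigma> \<A> p S"
  unfolding collapsible_def
proof (intro allI impI, elim conjE)
  fix m and \<phi> :: "('a, nat) prenex"
  assume "m \<ge> 1" and pH: "pH_sentence \<sigma> \<phi>" and count: "count_universal (quants \<phi>) = m"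
    and adv: "models_adversaries \<A> \<phi> (Upsilon (carrier \<A>) m p S)"
  then have "reactively_composable \<sigma> \<A> m (Upsilon (carrier \<A>) m p S)"
    using assms(2) by blast
  from models_full_adversary_if_composable[OF assms(1) pH count this adv] show "models \<A> \<phi>"
    using models_if_models_full_adversary[OF pH] count by simp
qed


section \<open>Generation from the canonical sentence of a power\<close>

lemma finite_diagram:
  assumes "finite (symbols \<sigma>)" and "finite V"
    and "\<And>R es. R \<in> symbols \<sigma> \<Longrightarrow> es \<in> interp P R \<Longrightarrow> length es = arity \<sigma> R"
  shows "finite (diagram \<sigma> P V elem)"
proof (rule finite_subset)
  show "diagram \<sigma> P V elem \<subseteq>
      (\<Union>R\<in>symbols \<sigma>. Rel R ` {vs. set vs \<subseteq> V \<and> length vs = arity \<sigma> R}) \<union>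
      case_prod Eq ` (V \<times> V)"
    using assms(3) by (fastforce simp: diagram_def)
qed (use assms finite_lists_length_eq[OF assms(2)] in auto)

text \<open>Variable \<open>v < m\<close> names the coordinate function
  \<open>s \<mapsto> s ! v\<close> on \<open>U\<close>. Truth of the canonical query yields a
  homomorphism with prescribed values on these functions, and such a homomorphism is an operation
  producing a prescribed tuple from those in \<open>U\<close>.\<close>

lemma generates_if_Pi2_collapsible:
  assumes fin: "finite_structure \<sigma> \<A>" and x: "x \<in> carrier \<A>"
    and coll: "Pi2_collapsible \<sigma> \<A> p {x}" and m: "m \<ge> 1"
  shows "generates \<sigma> \<A> m (Upsilon (carrier \<A>) m p {x})"
proof -
  let ?A = "carrier \<A>" and ?\<Omega> = "Upsilon (carrier \<A>) m p {x}"
  define U where "U = \<Union> ?\<Omega>"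
  let ?P = "power_structure \<sigma> U \<A>"
  have U: "U \<subseteq> tuples ?A m"
    using x Union_Upsilon_subset_tuples[of "{x}" ?A m p] by (simp add: U_def)
  have finA: "finite ?A" and finU: "finite U"
    using fin finite_subset[OF U] finite_tuples by (auto simp: finite_structure_def)
  define N where "N = card (carrier ?P)"
  have "finite (carrier ?P)"
    using finA finU by (auto intro: finite_PiE)
  \<comment> \<open>Collapsibility speaks of sentences whose variables are natural numbers, so the
    elements of the power are numbered.\<close>
  then obtain c where c: "bij_betw c {..<N} (carrier ?P)"
    using ex_bij_betw_nat_finite unfolding N_def by (metis atLeast0LessThan)
  \<comment> \<open>The existential variables name all elements of the power, including those that
    universal variables name; equality atoms tie duplicate names together.\<close>
  define us es where "us = [0..<m]" and "es = [m..<m + N]"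
  let ?V = "set us \<union> set es"
  define elem where "elem = (\<lambda>v. if v < m then (\<lambda>s\<in>U. s ! v) else c (v - m))"
  define \<phi> where "\<phi> = \<lparr>quants = map (Pair Forall) us @ map (Pair Exists) es,
    body = diagram \<sigma> ?P ?V elem\<rparr>"
  have dist: "distinct (us @ es)"
    by (auto simp: us_def es_def)
  have "elem ` set us \<subseteq> carrier ?P"
    using U by (auto simp: elem_def us_def in_tuples_iff)
  moreover have "elem ` set es = carrier ?P"
  proof -
    have "elem ` set es = c ` (\<lambda>v. v - m) ` {m..<m + N}"
      by (auto simp: elem_def es_def image_image)
    also have "(\<lambda>v. v - m) ` {m..<m + N} = {..<N}"
    proof (intro equalityI subsetI)
      show "i \<in> (\<lambda>v. v - m) ` {m..<m + N}" if "i \<in> {..<N}" for i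
        using that by (intro image_eqI[of _ _ "i + m"]) auto
    qed auto
    finally show ?thesis
      using c by (simp add: bij_betw_def)
  qed
  ultimately have surj: "elem ` ?V = carrier ?P"
    by auto
  have pH: "pH_sentence \<sigma> \<phi>"
    unfolding pH_sentence_def
  proof (intro conjI ballI)
    show "distinct (map snd (quants \<phi>))"
      using dist by (simp add: \<phi>_def comp_def)
    show "finite (body \<phi>)"
      using fin unfolding \<phi>_def
      by (auto simp: finite_structure_def in_interp_power_iff in_tuples_iff intro!: finite_diagram)
    show "atom_in_signature \<sigma> \<alpha>" if "\<alpha> \<in> body \<phi>" for \<alpha>
      using that by (auto simp: \<phi>_def diagram_def in_interp_power_iff in_tuples_iff)
    show "atom_vars \<alpha> \<subseteq> snd ` set (quants \<phi>)" if "\<alpha> \<in> body \<phi>" for \<alpha>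
      using that diagram_vars[of \<alpha> \<sigma> ?P ?V elem] by (simp add: \<phi>_def image_Un image_image)
  qed
  have ub_us: "universals_before \<phi> v = v" if "v < m" for v
  proof -
    have "us = [0..<v] @ v # [Suc v..<m]"
      using upt_add_eq_append[of 0 v "m - v"] upt_conv_Cons[of v m] that by (simp add: us_def)
    then have q: "quants \<phi> = map (Pair Forall) [0..<v] @ (Forall, v) #
        (map (Pair Forall) [Suc v..<m] @ map (Pair Exists) es)"
      by (simp add: \<phi>_def)
    show ?thesis
      using universals_before_append[OF q] pH by (simp add: pH_sentence_def)
  qed
  have ub_es: "universals_before \<phi> v = m" if v: "v \<in> set es" for v
  proof -
    obtain e1 e2 where "es = e1 @ v # e2"
      using split_list[OF v] by blast
    then have q: "quants \<phi> = (map (Pair Forall) us @ map (Pair Exists) e1) @ (Exists, v) #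
        map (Pair Exists) e2"
      by (simp add: \<phi>_def)
    have "universals_before \<phi> v = count_universal (map (Pair Forall) us @ map (Pair Exists) e1)"
      using universals_before_append[OF q] pH by (simp add: pH_sentence_def)
    then show ?thesis by (simp add: us_def)
  qed
  have "models_adversary \<A> \<phi> B" if B: "B \<in> ?\<Omega>" for B
  proof -
    \<comment> \<open>On a play \<open>t\<close> in \<open>U\<close> the Skolem functions follow the
      projection at \<open>t\<close>; elsewhere \<open>x\<close> is a default that keeps the values
      in the domain.\<close>
    define s where "s = (\<lambda>v t. if t \<in> U \<and> v \<in> ?V then elem v t else x)"
    have "s v t \<in> ?A" for v t
      using surj x unfolding s_def by (auto simp: PiE_iff)
    moreover have "atom_holds \<A> (skolem_env \<phi> s t) \<alpha>" if t: "t \<in> B" and \<alpha>: "\<alpha> \<in> body \<phi>" for t \<alpha>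
    proof (rule homomorphism_satisfies_diagram)
      have tU: "t \<in> U" using t B by (auto simp: U_def)
      then show "homomorphism \<sigma> ?P \<A> (\<lambda>e. e t)"
        by (rule homomorphism_projection)
      show "\<alpha> \<in> diagram \<sigma> ?P ?V elem"
        using \<alpha> by (simp add: \<phi>_def)
      show "skolem_env \<phi> s t v = elem v t" if "v \<in> ?V" for v
      proof (cases "v < m")
        case True
        then have "(Forall, v) \<in> set (quants \<phi>)"
          by (simp add: \<phi>_def us_def)
        then show ?thesis
          using True tU by (simp add: skolem_env_def ub_us elem_def)
      next
        case False
        then have v: "v \<in> set es" and "(Forall, v) \<notin> set (quants \<phi>)"
          using that by (auto simp: \<phi>_def us_def)
        moreover have "length t = m"
          using tU U by (auto simp: in_tuples_iff)
        ultimately show ?thesis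
          using tU by (simp add: skolem_env_def ub_es s_def)
      qed
    qed
    ultimately show ?thesis
      unfolding models_adversary_def by blast
  qed
  moreover have "Pi2 \<phi>" "count_universal (quants \<phi>) = m"
    by (auto simp: Pi2_def \<phi>_def us_def)
  ultimately have "models \<A> \<phi>"
    using coll pH m unfolding Pi2_collapsible_def models_adversaries_def by blast
  then have hom: "\<exists>H. homomorphism \<sigma> ?P \<A> H \<and> (\<forall>u \<in> set us. H (elem u) = h u)"
    if "\<forall>u \<in> set us. h u \<in> ?A" for h
    using models_diagram_iff[of \<phi> us es \<sigma> ?P elem \<A>, OF _ dist _ surj] that
    by (auto simp: \<phi>_def in_interp_power_iff tuples_def)
  obtain L where L: "set L = U" "distinct L"
    using finite_distinct_list[OF finU] by blast
  have "U \<noteq> {}"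
    using Upsilon_nonempty[of ?A m p "{x}"] replicate_in_Upsilon[OF x] unfolding U_def by blast
  then have k: "length L \<ge> 1"
    using L(1) by (cases L) auto
  have "\<forall>s \<in> U. \<exists>i < length L. L ! i = s"
    using L(1) by (auto simp: in_set_conv_nth)
  then obtain pos where pos: "\<And>s. s \<in> U \<Longrightarrow> pos s < length L" "\<And>s. s \<in> U \<Longrightarrow> L ! pos s = s"
    by metis
  show ?thesis
    unfolding generates_def
  proof
    fix t assume t: "t \<in> tuples ?A m"
    then have "\<forall>u \<in> set us. t ! u \<in> ?A"
      by (simp add: us_def in_tuples_iff)
    then obtain H where H: "homomorphism \<sigma> ?P \<A> H" "\<forall>u \<in> set us. H (elem u) = t ! u"
      using hom by blast
    \<comment> \<open>Argument \<open>pos s\<close> belongs to the generator \<open>s\<close>, so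
      feeding in the \<open>i\<close>-th entries of all generators presents \<open>elem i\<close> to
      \<open>H\<close>.\<close>
    let ?f = "\<lambda>t. H (\<lambda>s\<in>U. t ! pos s)"
    have "polymorphism \<sigma> \<A> (length L) ?f"
      using polymorphism_of_homomorphism[OF fin H(1) _ k] pos by blast
    moreover have "t = apply_coordwise ?f m L"
    proof (rule nth_equalityI)
      fix i assume "i < length t"
      then have i: "i < m" using t by (simp add: in_tuples_iff)
      have "(\<lambda>s\<in>U. map (\<lambda>t. t ! i) L ! pos s) = elem i"
        using i pos by (auto simp: elem_def)
      then show "t ! i = apply_coordwise ?f m L ! i"
        using H(2) i by (simp add: apply_coordwise_def us_def)
    qed (use t in \<open>simp add: in_tuples_iff apply_coordwise_def\<close>)
    ultimately show "\<exists>k f ts. polymorphism \<sigma> \<A> k f \<and> length ts = k \<and> set ts \<subseteq> \<Union> ?\<Omega> \<and>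
        t = apply_coordwise f m ts"
      using L(1) U_def by blast
  qed
qed


section \<open>Maps generated by an adversary set\<close>

text \<open>With maps read as tuples indexed by \<open>{..<n} \<times> {..<m}\<close>,
  \<open>h\<close> is obtained from the maps consistent with members of \<open>\<Omega>\<close> by
  one relation-preserving operation that has an argument for each factor.\<close>

definition generates_map ::
  "'r signature \<Rightarrow> ('r, 'a) rel_structure \<Rightarrow> nat \<Rightarrow> nat \<Rightarrow> 'a list set set
     \<Rightarrow> (nat \<times> nat \<Rightarrow> 'a) \<Rightarrow> bool" where
  "generates_map \<sigma> \<A> n m \<Omega> h \<longleftrightarrow>
     (\<exists>H. homomorphism \<sigma> (power_structure \<sigma> (factors (carrier \<A>) n m \<Omega>) \<A>) \<A> H \<and>
          (\<forall>z \<in> {..<n} \<times> {..<m}. H (product_constant (carrier \<A>) n m \<Omega> z) = h z))"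

lemma generates_map_cong:
  "generates_map \<sigma> \<A> n m \<Omega> h \<Longrightarrow> (\<And>z. z \<in> {..<n} \<times> {..<m} \<Longrightarrow> h z = h' z) \<Longrightarrow>
     generates_map \<sigma> \<A> n m \<Omega> h'"
  by (simp add: generates_map_def)

lemma generates_map_factor:
  assumes "b \<in> factors (carrier \<A>) n m \<Omega>"
  shows "generates_map \<sigma> \<A> n m \<Omega> (snd b)"
  unfolding generates_map_def
  using homomorphism_projection[OF assms, of \<sigma> \<A>] product_constant_apply[OF assms] by blast

lemma generates_map_homomorphism:
  assumes "homomorphism \<sigma> (power_structure \<sigma> J \<A>) \<A> H"
    and "\<And>j. j \<in> J \<Longrightarrow> generates_map \<sigma> \<A> n m \<Omega> (h j)"
  shows "generates_map \<sigma> \<A> n m \<Omega> (\<lambda>z. H (\<lambda>j\<in>J. h j z))"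
proof -
  let ?P = "power_structure \<sigma> (factors (carrier \<A>) n m \<Omega>) \<A>"
  let ?c = "product_constant (carrier \<A>) n m \<Omega>"
  obtain K where K: "\<And>j. j \<in> J \<Longrightarrow> homomorphism \<sigma> ?P \<A> (K j)"
    and Kc: "\<And>j z. j \<in> J \<Longrightarrow> z \<in> {..<n} \<times> {..<m} \<Longrightarrow> K j (?c z) = h j z"
    using assms(2) unfolding generates_map_def by metis
  have "H (\<lambda>j\<in>J. K j (?c z)) = H (\<lambda>j\<in>J. h j z)" if "z \<in> {..<n} \<times> {..<m}" for z
    using Kc that by (metis (mono_tags, lifting) restrict_ext)
  moreover have "homomorphism \<sigma> ?P \<A> (\<lambda>e. H (\<lambda>j\<in>J. K j e))"
    by (rule homomorphism_compose[OF assms(1) K])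
  ultimately show ?thesis
    unfolding generates_map_def by blast
qed

text \<open>Witnesses for the factors are substituted into the witness for \<open>h\<close>. This
  allows a descent that removes one free position at a time.\<close>

lemma generates_map_trans:
  assumes "generates_map \<sigma> \<A> n m \<Omega> h"
    and "\<And>b. b \<in> factors (carrier \<A>) n m \<Omega> \<Longrightarrow> generates_map \<sigma> \<A> n m \<Omega>' (snd b)"
  shows "generates_map \<sigma> \<A> n m \<Omega>' h"
proof -
  let ?F = "factors (carrier \<A>) n m \<Omega>"
  obtain H where H: "homomorphism \<sigma> (power_structure \<sigma> ?F \<A>) \<A> H"
    and Hc: "\<And>z. z \<in> {..<n} \<times> {..<m} \<Longrightarrow> H (product_constant (carrier \<A>) n m \<Omega> z) = h z"
    using assms(1) unfolding generates_map_def by blast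
  \<comment> \<open>Evaluating all factor maps at \<open>z\<close> gives the element of the product
    named by \<open>z\<close>.\<close>
  have "(\<lambda>b\<in>?F. snd b z) = product_constant (carrier \<A>) n m \<Omega> z" for z
    by (auto simp: product_constant_def)
  then have "H (\<lambda>b\<in>?F. snd b z) = h z" if "z \<in> {..<n} \<times> {..<m}" for z
    using Hc that by simp
  with generates_map_homomorphism[OF H assms(2)] show ?thesis
    by (rule generates_map_cong)
qed

section \<open>From generated tuples to generated maps\<close>

lemma generates_map_if_generates:
  assumes x: "x \<in> carrier \<A>" and n: "n > 0"
    and gen: "generates \<sigma> \<A> (n * (p + 1)) (Upsilon (carrier \<A>) (n * (p + 1)) p {x})"
    and h: "\<And>z. z \<in> {..<n} \<times> {..<p + 1} \<Longrightarrow> h z \<in> carrier \<A>"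
  shows "generates_map \<sigma> \<A> n (p + 1) (Upsilon (carrier \<A>) (p + 1) p {x}) h"
proof -
  let ?A = "carrier \<A>" and ?M = "n * (p + 1)" and ?Z = "{..<n} \<times> {..<p + 1}"
  let ?\<Omega> = "Upsilon ?A (p + 1) p {x}"
  \<comment> \<open>Row-major position in the flattened array, so that the column of an entry is its
    residue modulo \<open>p + 1\<close>.\<close>
  define r where "r = (\<lambda>(i, j). i * (p + 1) + j)"
  have r: "r z < ?M" "r z div (p + 1) = fst z" "r z mod (p + 1) = snd z" if zZ: "z \<in> ?Z" for z
  proof -
    obtain i j where z: "z = (i, j)" "i < n" "j < p + 1" using zZ by auto
    have "i * (p + 1) + j < Suc i * (p + 1)" using z by simp
    also have "\<dots> \<le> ?M" using z by (intro mult_le_mono1) simp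
    finally show "r z < ?M" by (simp add: r_def z)
    show "r z div (p + 1) = fst z" "r z mod (p + 1) = snd z"
      using z by (simp_all add: r_def del: mult_Suc_right)
  qed
  define t where "t = map (\<lambda>q. h (q div (p + 1), q mod (p + 1))) [0..<?M]"
  have "t \<in> tuples ?A ?M"
    using h by (auto simp: t_def in_tuples_iff less_mult_imp_div_less)
  then obtain k f ts where f: "polymorphism \<sigma> \<A> k f" and ts: "length ts = k"
      "set ts \<subseteq> \<Union> (Upsilon ?A ?M p {x})" and t_eq: "t = apply_coordwise f ?M ts"
    using gen unfolding generates_def by blast
  have "generates_map \<sigma> \<A> n (p + 1) ?\<Omega> (\<lambda>z. ts ! q ! r z)" if q: "q < k" for q
  proof -
    define s where "s = ts ! q"
    have "s \<in> \<Union> (Upsilon ?A ?M p {x})"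
      unfolding s_def using ts q nth_mem by blast
    then obtain I where I: "I \<subseteq> {..<?M}" "card I = min p ?M" and s: "s \<in> block ?A ?M {x} I"
      unfolding Upsilon_eq by blast
    \<comment> \<open>At most \<open>p\<close> entries of \<open>s\<close> differ from \<open>x\<close>, so one of the \<open>p + 1\<close> columns is constant.\<close>
    have "card ((\<lambda>i. i mod (p + 1)) ` I) < card {..<p + 1}"
      using card_image_le[of I "\<lambda>i. i mod (p + 1)"] I finite_subset[OF I(1)] by auto
    then have "\<not> {..<p + 1} \<subseteq> (\<lambda>i. i mod (p + 1)) ` I"
      using card_mono[of "(\<lambda>i. i mod (p + 1)) ` I" "{..<p + 1}"] finite_subset[OF I(1)] by fastforce
    then obtain l where l: "l < p + 1" "l \<notin> (\<lambda>i. i mod (p + 1)) ` I"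
      by auto
    let ?B = "block ?A (p + 1) {x} ({..<p + 1} - {l})"
    let ?\<mu> = "\<lambda>z\<in>?Z. s ! r z"
    have "card ({..<p + 1} - {l}) = p" using l by simp
    then have "?B \<in> ?\<Omega>"
      unfolding Upsilon_eq by (intro CollectI exI[of _ "{..<p + 1} - {l}"]) auto
    moreover have "?\<mu> \<in> consistent_maps ?A n (p + 1) ?B"
    proof -
      have "s ! r z \<in> ?A" if "z \<in> ?Z" for z
        using s r(1)[OF that] x by (auto simp: in_block_iff split: if_splits)
      moreover have "s ! r (i, l) = x" if "i < n" for i
      proof -
        have z: "(i, l) \<in> ?Z" using that l by simp
        have "r (i, l) \<notin> I" using l(2) r(3)[OF z] by (metis image_eqI snd_conv)
        then show ?thesis
          using s r(1)[OF z] by (auto simp: in_block_iff)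
      qed
      ultimately show ?thesis
        unfolding consistent_maps_block_iff[OF n x] by auto
    qed
    ultimately have "(?B, ?\<mu>) \<in> factors ?A n (p + 1) ?\<Omega>"
      by (simp add: factors_def)
    then have "generates_map \<sigma> \<A> n (p + 1) ?\<Omega> ?\<mu>"
      using generates_map_factor by fastforce
    then show ?thesis
      by (rule generates_map_cong) (simp add: s_def)
  qed
  then have "generates_map \<sigma> \<A> n (p + 1) ?\<Omega>
      (\<lambda>z. f (map (\<lambda>q\<in>{..<k}. ts ! q ! r z) [0..<k]))"
    using generates_map_homomorphism[OF homomorphism_of_polymorphism[OF f], of n "p + 1" ?\<Omega>
        "\<lambda>q z. ts ! q ! r z"] by simp
  moreover have "f (map (\<lambda>q\<in>{..<k}. ts ! q ! r z) [0..<k]) = h z" if "z \<in> ?Z" for z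
  proof -
    have "map (\<lambda>q\<in>{..<k}. ts ! q ! r z) [0..<k] = map (\<lambda>s. s ! r z) ts"
      using ts(1) by (intro nth_equalityI) auto
    then have "f (map (\<lambda>q\<in>{..<k}. ts ! q ! r z) [0..<k]) = t ! r z"
      unfolding t_eq using r(1)[OF that] by (simp add: apply_coordwise_def)
    then show ?thesis
      using r[OF that] by (simp add: t_def)
  qed
  ultimately show ?thesis
    by (rule generates_map_cong)
qed

section \<open>Descent in the number of free positions\<close>

text \<open>The hypothesis \<open>gen\<close> expresses each element through its row in each of the
  \<open>p + 1\<close> columns. Substituting this at the free positions replaces \<open>h\<close> by
  one map per factor, each with a free position fewer; positions outside \<open>I\<close> stay at
  \<open>x\<close> because homomorphisms from powers fix \<open>x\<close>.\<close>

lemma generates_map_reduce: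
  fixes \<A> :: "('r, 'a) rel_structure"
  assumes fin: "finite_structure \<sigma> \<A>" and named: "named_by_constant \<sigma> \<A> x"
    and x: "x \<in> carrier \<A>" and n: "n > 0"
    and enum: "bij_betw enum {..<n} (carrier \<A>)"
    and gen: "generates_map \<sigma> \<A> n (p + 1) (Upsilon (carrier \<A>) (p + 1) p {x}) (\<lambda>(i, j). enum i)"
    and q: "p \<le> q" "q < m"
    and b: "b \<in> factors (carrier \<A>) n m (Upsilon (carrier \<A>) m (Suc q) {x})"
  shows "generates_map \<sigma> \<A> n m (Upsilon (carrier \<A>) m q {x}) (snd b)"
proof -
  let ?A = "carrier \<A>" and ?Z = "{..<n} \<times> {..<m}"
  let ?\<Omega> = "Upsilon ?A m q {x}" and ?\<Xi> = "Upsilon ?A (p + 1) p {x}"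
  let ?F = "factors ?A n (p + 1) ?\<Xi>"
  \<comment> \<open>\<open>idx\<close> turns a value into the row that \<open>gen\<close> sends back
    to it.\<close>
  define idx where "idx = inv_into {..<n} enum"
  have idx: "idx a < n" "enum (idx a) = a" if "a \<in> ?A" for a
    using enum that unfolding idx_def bij_betw_def
    by (metis f_inv_into_f inv_into_into lessThan_iff)+
  obtain H where H: "homomorphism \<sigma> (power_structure \<sigma> ?F \<A>) \<A> H"
    and Hc: "\<And>i j. i < n \<Longrightarrow> j < p + 1 \<Longrightarrow>
        H (product_constant ?A n (p + 1) ?\<Xi> (i, j)) = enum i"
    using gen unfolding generates_map_def by fastforce
  obtain B h where bh: "b = (B, h)" by force
  obtain I where I: "I \<subseteq> {..<m}" "card I = Suc q" and B: "B = block ?A m {x} I"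
    using b q by (auto simp: bh factors_def Upsilon_eq min_def)
  have h: "h \<in> ?Z \<rightarrow>\<^sub>E ?A" and hx: "\<And>i j. i < n \<Longrightarrow> j < m \<Longrightarrow> j \<notin> I \<Longrightarrow> h (i, j) = x"
    using b consistent_maps_block_iff[OF n x] by (auto simp: bh factors_def B)
  have finI: "finite I" using I(1) finite_subset by blast
  \<comment> \<open>Any surjection from the \<open>q + 1\<close> free positions onto the
    \<open>p + 1\<close> columns will do, and \<open>p \<le> q\<close> provides one: here all excess
    positions go to the last column.\<close>
  obtain \<rho> where \<rho>: "\<rho> ` I = {..<p + 1}"
  proof -
    obtain e where e: "bij_betw e I {0..<Suc q}"
      using ex_bij_betw_finite_nat[OF finI] I(2) by auto
    have "(\<lambda>i. min (e i) p) ` I = (\<lambda>i. min i p) ` e ` I"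
      by (simp add: image_image)
    also have "e ` I = {0..<Suc q}"
      using e by (rule bij_betw_imp_surj_on)
    also have "(\<lambda>i. min i p) ` {0..<Suc q} = {..<p + 1}"
    proof (intro equalityI subsetI)
      show "i \<in> (\<lambda>i. min i p) ` {0..<Suc q}" if "i \<in> {..<p + 1}" for i
        using that q by (intro image_eqI[of _ _ i]) auto
    qed auto
    finally show ?thesis using that by blast
  qed
  \<comment> \<open>The coordinate in \<open>I\<close> sent by \<open>\<rho>\<close> to the column on which \<open>b0\<close> is \<open>x\<close> becomes \<open>x\<close>,
    while applying \<open>H\<close> over all \<open>b0\<close> restores \<open>h\<close>.\<close>
  define \<psi> :: "'a list set \<times> (nat \<times> nat \<Rightarrow> 'a) \<Rightarrow> nat \<times> nat \<Rightarrow> 'a"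
    where "\<psi> = (\<lambda>b0 (i, j). if j \<in> I then snd b0 (idx (h (i, j)), \<rho> j) else x)"
  have "generates_map \<sigma> \<A> n m ?\<Omega> (\<psi> b0)" if b0: "b0 \<in> ?F" for b0
  proof -
    obtain B0 \<mu> where b0_eq: "b0 = (B0, \<mu>)" by force
    obtain I0 where I0: "I0 \<subseteq> {..<p + 1}" "card I0 = p" and B0: "B0 = block ?A (p + 1) {x} I0"
      using b0 by (auto simp: b0_eq factors_def Upsilon_eq)
    have \<mu>: "\<mu> \<in> ({..<n} \<times> {..<p + 1}) \<rightarrow>\<^sub>E ?A"
      and \<mu>x: "\<And>i j. i < n \<Longrightarrow> j < p + 1 \<Longrightarrow> j \<notin> I0 \<Longrightarrow> \<mu> (i, j) = x"
      using b0 consistent_maps_block_iff[OF n x] by (auto simp: b0_eq factors_def B0)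
    \<comment> \<open>With \<open>p\<close> of the \<open>p + 1\<close> columns free, some column
      \<open>l\<close> of \<open>\<mu>\<close> is constantly \<open>x\<close>.\<close>
    have "I0 \<subset> {..<p + 1}"
      using I0 by (metis card_lessThan less_add_one less_irrefl psubsetI)
    then obtain l where "l \<in> {..<p + 1} - I0"
      using psubset_imp_ex_mem by blast
    then have l: "l < p + 1" "l \<notin> I0" by auto
    then have "l \<in> \<rho> ` I" using \<rho> by simp
    then obtain j0 where j0: "j0 \<in> I" "\<rho> j0 = l" by blast
    let ?B = "block ?A m {x} (I - {j0})"
    have "card (I - {j0}) = q" using I(2) j0(1) finI by simp
    then have "?B \<in> ?\<Omega>"
      unfolding Upsilon_eq using I(1) q by (intro CollectI exI[of _ "I - {j0}"]) auto
    moreover have "restrict (\<psi> b0) ?Z \<in> consistent_maps ?A n m ?B"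
    proof -
      have idx_h: "idx (h (i, j)) < n" if "i < n" "j < m" for i j
        using h that idx(1) by (auto simp: PiE_iff)
      moreover have "\<rho> j < p + 1" if "j \<in> I" for j
        using \<rho> that by blast
      ultimately have "\<psi> b0 (i, j) \<in> ?A" if "i < n" "j < m" for i j
        using \<mu> x that by (auto simp: \<psi>_def b0_eq PiE_iff)
      moreover have "\<psi> b0 (i, j) = x" if "i < n" "j < m" "j \<notin> I - {j0}" for i j
        using that \<mu>x[OF idx_h l] j0 by (auto simp: \<psi>_def b0_eq)
      ultimately show ?thesis
        unfolding consistent_maps_block_iff[OF n x] by auto
    qed
    ultimately have "(?B, restrict (\<psi> b0) ?Z) \<in> factors ?A n m ?\<Omega>"
      by (simp add: factors_def)
    then have "generates_map \<sigma> \<A> n m ?\<Omega> (restrict (\<psi> b0) ?Z)"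
      using generates_map_factor by fastforce
    then show ?thesis
      by (rule generates_map_cong) simp
  qed
  then have "generates_map \<sigma> \<A> n m ?\<Omega> (\<lambda>z. H (\<lambda>b0\<in>?F. \<psi> b0 z))"
    by (rule generates_map_homomorphism[OF H])
  moreover have "H (\<lambda>b0\<in>?F. \<psi> b0 z) = h z" if z: "z \<in> ?Z" for z
  proof -
    obtain i j where ij: "z = (i, j)" "i < n" "j < m" using z by auto
    show ?thesis
    proof (cases "j \<in> I")
      case True
      have "h z \<in> ?A" using h z by (auto simp: PiE_iff)
      moreover have "\<rho> j < p + 1" using \<rho> True by blast
      moreover have "(\<lambda>b0\<in>?F. \<psi> b0 z) = product_constant ?A n (p + 1) ?\<Xi> (idx (h z), \<rho> j)"
        using True by (auto simp: \<psi>_def ij product_constant_def)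
      ultimately show ?thesis
        using Hc idx by simp
    next
      case False
      then have "(\<lambda>b0\<in>?F. \<psi> b0 z) = (\<lambda>b0\<in>?F. x)"
        by (auto simp: \<psi>_def ij)
      then show ?thesis
        using homomorphism_const[OF fin named H] hx False ij by simp
    qed
  qed
  ultimately show ?thesis
    unfolding bh snd_conv by (rule generates_map_cong)
qed

text \<open>With all \<open>m\<close> positions free, \<open>h\<close> restricted to its index set
  is itself a factor map; free positions are then removed one at a time.\<close>

lemma generates_map_full:
  assumes fin: "finite_structure \<sigma> \<A>" and named: "named_by_constant \<sigma> \<A> x"
    and x: "x \<in> carrier \<A>" and n: "n > 0"
    and enum: "bij_betw enum {..<n} (carrier \<A>)"
    and gen: "generates_map \<sigma> \<A> n (p + 1) (Upsilon (carrier \<A>) (p + 1) p {x}) (\<lambda>(i, j). enum i)"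
    and h: "\<And>z. z \<in> {..<n} \<times> {..<m} \<Longrightarrow> h z \<in> carrier \<A>"
  shows "generates_map \<sigma> \<A> n m (Upsilon (carrier \<A>) m p {x}) h"
proof -
  let ?A = "carrier \<A>" and ?Z = "{..<n} \<times> {..<m}"
  \<comment> \<open>The maximum covers both cases: for \<open>m \<le> p\<close> there is nothing to
    descend, and \<open>min q m = m\<close> makes every position free at the start.\<close>
  define q where "q = max p m"
  have "generates_map \<sigma> \<A> n m (Upsilon ?A m p {x}) (snd b)"
    if "b \<in> factors ?A n m (Upsilon ?A m r {x})" "p \<le> r" "r \<le> q" for b r
    using that(2,3,1)
  proof (induction r arbitrary: b rule: dec_induct)
    case base
    then show ?case by (simp add: generates_map_factor)
  next
    case (step r)
    then have "r < m" by (simp add: q_def)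
    then show ?case
      using generates_map_trans[OF generates_map_reduce[OF fin named x n enum gen]] step by simp
  qed
  moreover have "(block ?A m {x} {..<m}, restrict h ?Z) \<in> factors ?A n m (Upsilon ?A m q {x})"
  proof -
    have "restrict h ?Z \<in> consistent_maps ?A n m (block ?A m {x} {..<m})"
      unfolding consistent_maps_block_iff[OF n x] using h by auto
    moreover have "block ?A m {x} {..<m} \<in> Upsilon ?A m q {x}"
      unfolding Upsilon_eq q_def by (intro CollectI exI[of _ "{..<m}"]) auto
    ultimately show ?thesis by (simp add: factors_def)
  qed
  ultimately have "generates_map \<sigma> \<A> n m (Upsilon ?A m p {x}) (restrict h ?Z)"
    unfolding q_def by (metis max.cobounded1 order_refl snd_conv)
  then show ?thesis
    by (rule generates_map_cong) simp
qed

section \<open>From generated maps to reactive composition\<close>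

text \<open>Rows encode moves: strategy \<open>j\<close> answers \<open>a ! i\<close> by the entry
  of the \<open>j\<close>-th factor map in row \<open>idx (a ! i)\<close> and column
  \<open>i\<close>. Consistency over all row tuples places the whole answer in the adversary, and
  \<open>H\<close> returns the encoded element.\<close>

lemma composable_if_generates_map:
  assumes fin: "finite_structure \<sigma> \<A>" and x: "x \<in> carrier \<A>"
    and enum: "bij_betw enum {..<n} (carrier \<A>)"
    and gen: "generates_map \<sigma> \<A> n m (Upsilon (carrier \<A>) m p {x}) (\<lambda>(i, j). enum i)"
  shows "reactively_composable \<sigma> \<A> m (Upsilon (carrier \<A>) m p {x})"
proof -
  let ?A = "carrier \<A>" and ?\<Omega> = "Upsilon (carrier \<A>) m p {x}"
  let ?F = "factors ?A n m ?\<Omega>"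
  define idx where "idx = inv_into {..<n} enum"
  have idx: "idx a < n" "enum (idx a) = a" if "a \<in> ?A" for a
    using enum that unfolding idx_def bij_betw_def
    by (metis f_inv_into_f inv_into_into lessThan_iff)+
  obtain H where H: "homomorphism \<sigma> (power_structure \<sigma> ?F \<A>) \<A> H"
    and Hc: "\<And>i j. i < n \<Longrightarrow> j < m \<Longrightarrow> H (product_constant ?A n m ?\<Omega> (i, j)) = enum i"
    using gen unfolding generates_map_def by fastforce
  have finF: "finite ?F"
    using fin by (simp add: finite_factors finite_structure_def)
  define k where "k = card ?F"
  have k: "k \<ge> 1"
    using finF factors_nonempty[OF x] unfolding k_def by (simp add: Suc_leI card_gt_0_iff)
  obtain b where b: "bij_betw b {..<k} ?F"
    using ex_bij_betw_nat_finite[OF finF] unfolding k_def by (metis atLeast0LessThan)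
  have bF: "b j \<in> ?F" if "j < k" for j
    using b that by (auto simp: bij_betw_def)
  define pos where "pos = inv_into {..<k} b"
  have pos: "pos c < k" "b (pos c) = c" if "c \<in> ?F" for c
    using b that unfolding pos_def bij_betw_def
    by (metis f_inv_into_f inv_into_into lessThan_iff)+
  define f where "f = (\<lambda>t. H (\<lambda>c\<in>?F. t ! pos c))"
  define Bs where "Bs = map (fst \<circ> b) [0..<k]"
  \<comment> \<open>Only the last entry of the prefix, the current move, is used.\<close>
  define g where "g = (\<lambda>i j t. if t \<in> tuples ?A (i + 1) then Some (snd (b j) (idx (last t), i)) else None)"
  \<comment> \<open>The list \<open>Bs\<close> has to enumerate all of \<open>Upsilon\<close>; the
    constant map ensures that no adversary is missing.\<close>
  have "fst ` ?F = ?\<Omega>"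
    using const_in_consistent_maps[OF x] by (force simp: factors_def)
  then have "set Bs = ?\<Omega>"
    using b by (simp add: Bs_def bij_betw_def atLeast0LessThan flip: image_image)
  moreover have "length Bs = k"
    by (simp add: Bs_def)
  moreover have "polymorphism \<sigma> \<A> k f"
    unfolding f_def using polymorphism_of_homomorphism[OF fin H _ k] pos by blast
  moreover have "dom (g i j) \<subseteq> tuples ?A (i + 1) \<and> ran (g i j) \<subseteq> ?A" if "i < m" "j < k" for i j
  proof -
    have "snd (b j) \<in> ({..<n} \<times> {..<m}) \<rightarrow>\<^sub>E ?A"
      using bF[OF \<open>j < k\<close>] consistent_maps_subset_PiE by (force simp: factors_def)
    moreover have "last t \<in> ?A" if "t \<in> tuples ?A (i + 1)" for t
      using that by (cases t rule: rev_cases) (auto simp: tuples_def)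
    ultimately show ?thesis
      using \<open>i < m\<close> idx(1) by (auto simp: g_def ran_def PiE_iff split: if_splits)
  qed
  moreover have "(\<forall>j<k. (\<forall>i<m. take (i + 1) a \<in> dom (g i j)) \<and>
        map (\<lambda>i. the (g i j (take (i + 1) a))) [0..<m] \<in> Bs ! j) \<and>
      (\<forall>i<m. a ! i = f (map (\<lambda>j. the (g i j (take (i + 1) a))) [0..<k]))"
    if a: "a \<in> tuples ?A m" for a
  proof -
    have take: "take (i + 1) a \<in> tuples ?A (i + 1)" "last (take (i + 1) a) = a ! i" "a ! i \<in> ?A"
      if "i < m" for i
      using a that set_take_subset[of "i + 1" a]
      by (auto simp: tuples_def take_Suc_conv_app_nth)
    have g: "g i j (take (i + 1) a) = Some (snd (b j) (idx (a ! i), i))" if "i < m" for i j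
      using take[OF that] by (simp add: g_def)
    have mem: "map (\<lambda>i. snd (b j) (idx (a ! i), i)) [0..<m] \<in> Bs ! j" if "j < k" for j
    proof -
      have "snd (b j) \<in> consistent_maps ?A n m (fst (b j))"
        using bF[OF that] by (auto simp: factors_def)
      moreover have "map idx a \<in> tuples {..<n} m"
        using a idx(1) by (auto simp: in_tuples_iff)
      ultimately have "map (\<lambda>i. snd (b j) (map idx a ! i, i)) [0..<m] \<in> fst (b j)"
        unfolding consistent_maps_def by blast
      moreover have "map (\<lambda>i. snd (b j) (map idx a ! i, i)) [0..<m] =
          map (\<lambda>i. snd (b j) (idx (a ! i), i)) [0..<m]"
        using a by (simp add: in_tuples_iff)
      ultimately show ?thesis
        using that by (simp add: Bs_def)
    qed
    have f_eq: "a ! i = f (map (\<lambda>j. snd (b j) (idx (a ! i), i)) [0..<k])" if "i < m" for i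
    proof -
      have "(\<lambda>c\<in>?F. map (\<lambda>j. snd (b j) (idx (a ! i), i)) [0..<k] ! pos c) =
          product_constant ?A n m ?\<Omega> (idx (a ! i), i)"
        using pos by (auto simp: product_constant_def)
      then show ?thesis
        unfolding f_def using Hc idx take(3)[OF that] that by simp
    qed
    show ?thesis
    proof (intro conjI allI impI)
      fix i j assume "i < m" "j < k"
      then show "take (i + 1) a \<in> dom (g i j)"
        using g by blast
    next
      fix j assume "j < k"
      have "map (\<lambda>i. the (g i j (take (i + 1) a))) [0..<m] =
          map (\<lambda>i. snd (b j) (idx (a ! i), i)) [0..<m]"
        using g by simp
      then show "map (\<lambda>i. the (g i j (take (i + 1) a))) [0..<m] \<in> Bs ! j"
        using mem[OF \<open>j < k\<close>] by (simp only:)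
    next
      fix i assume "i < m"
      then have "map (\<lambda>j. the (g i j (take (i + 1) a))) [0..<k] =
          map (\<lambda>j. snd (b j) (idx (a ! i), i)) [0..<k]"
        using g by simp
      then show "a ! i = f (map (\<lambda>j. the (g i j (take (i + 1) a))) [0..<k])"
        using f_eq[OF \<open>i < m\<close>] by (simp only:)
    qed
  qed
  ultimately show ?thesis
    unfolding reactively_composable_def
    by (intro exI[of _ k] exI[of _ Bs] exI[of _ f] exI[of _ g]) blast
qed

section \<open>The cycle of implications\<close>

theorem theorem8:
  fixes \<sigma> :: "'r signature" and \<A> :: "('r, 'a) rel_structure" and x :: 'a and n p :: nat
  assumes "finite_structure \<sigma> \<A>"
    and "card (carrier \<A>) = n"
    and "x \<in> carrier \<A>"
    and "named_by_constant \<sigma> \<A> x"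
    and "p > 0"
  shows "(collapsible \<sigma> \<A> p {x} \<longleftrightarrow>
            (\<forall>m \<ge> 1. reactively_composable \<sigma> \<A> m (Upsilon (carrier \<A>) m p {x})))
       \<and> (collapsible \<sigma> \<A> p {x} \<longleftrightarrow> Pi2_collapsible \<sigma> \<A> p {x})
       \<and> (collapsible \<sigma> \<A> p {x} \<longleftrightarrow>
            (\<forall>m \<ge> 1. generates \<sigma> \<A> m (Upsilon (carrier \<A>) m p {x})))
       \<and> (collapsible \<sigma> \<A> p {x} \<longleftrightarrow>
            models \<A> (canonical_sentence \<sigma> \<A> n (p + 1) (Upsilon (carrier \<A>) (p + 1) p {x})))"
    (is "(?i \<longleftrightarrow> ?ii) \<and> (_ \<longleftrightarrow> ?iii) \<and> (_ \<longleftrightarrow> ?iv) \<and> (_ \<longleftrightarrow> ?v)")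
proof -
  have fin: "finite (carrier \<A>)" and n: "n > 0"
    using assms by (auto simp: finite_structure_def card_gt_0_iff)
  obtain enum where enum: "bij_betw enum {..<n} (carrier \<A>)"
    using ex_bij_betw_nat_finite[OF fin] assms(2) by (metis atLeast0LessThan)
  have enum_in: "enum i \<in> carrier \<A>" if "i < n" for i
    using enum that by (auto simp: bij_betw_def)
  have v: "?v \<longleftrightarrow> (\<forall>h. (\<forall>z \<in> {..<n} \<times> {..<p + 1}. h z \<in> carrier \<A>) \<longrightarrow>
      generates_map \<sigma> \<A> n (p + 1) (Upsilon (carrier \<A>) (p + 1) p {x}) h)"
    unfolding generates_map_def
    by (rule models_canonical_sentence_iff[OF fin finite_factors[OF fin]])
  have "?v \<Longrightarrow> ?ii"
  proof (intro allI impI)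
    fix m :: nat
    assume ?v
    \<comment> \<open>One assignment of the universal variables suffices: every column lists the
      whole domain in the order of \<open>enum\<close>.\<close>
    moreover have "\<forall>z \<in> {..<n} \<times> {..<p + 1}. (case z of (i, j) \<Rightarrow> enum i) \<in> carrier \<A>"
      using enum_in by auto
    ultimately have "generates_map \<sigma> \<A> n (p + 1) (Upsilon (carrier \<A>) (p + 1) p {x}) (\<lambda>(i, j). enum i)"
      using v by blast
    then have "generates_map \<sigma> \<A> n m (Upsilon (carrier \<A>) m p {x}) (\<lambda>(i, j). enum i)"
      by (rule generates_map_full[OF assms(1,4,3) n enum]) (use enum_in in auto)
    then show "reactively_composable \<sigma> \<A> m (Upsilon (carrier \<A>) m p {x})"
      by (rule composable_if_generates_map[OF assms(1,3) enum])
  qed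
  moreover have "?ii \<Longrightarrow> ?i"
    using collapsible_if_composable[OF assms(1)] .
  moreover have "?i \<Longrightarrow> ?iii"
    unfolding collapsible_def Pi2_collapsible_def by blast
  moreover have "?iii \<Longrightarrow> ?iv"
    using generates_if_Pi2_collapsible[OF assms(1,3)] by blast
  moreover have "?iv \<Longrightarrow> ?v"
  proof -
    assume ?iv
    \<comment> \<open>This length gives one entry for each universal variable of the canonical
      sentence.\<close>
    moreover have "n * (p + 1) \<ge> 1" using n by simp
    ultimately have gen: "generates \<sigma> \<A> (n * (p + 1)) (Upsilon (carrier \<A>) (n * (p + 1)) p {x})"
      by blast
    show ?v
      unfolding v
      by (intro allI impI, rule generates_map_if_generates[OF assms(3) n gen]) (erule (1) bspec)
  qed
  ultimately show ?thesis by blast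
qed

end
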